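(* Let $\mu_i=\mathcal N(m_i,\Sigma_i)$, $i\in\{1,\dots,p\}$, be Gaussian measures on $\mathbb R^d$ with $\Sigma_i\succ0$. The optimal plan of the multimarginal optimal transport problem $$\inf_{\pi\in\Pi(\mu_1,\dots,\mu_p)}\int\sum_{i=1}^p\sum_{j=i+1}^p\|x_i-x_j\|_2^2\,d\pi(x_1,\dots,x_p)$$ is given by the Gaussian measure $$\mathcal N\left(\begin{bmatrix}m_1\\ m_2\\ \vdots\\ m_p\end{bmatrix},\ \begin{bmatrix}\Sigma_1&C_{12}&\cdots&C_{1p}\\ C_{12}^\top&\Sigma_2&\cdots&C_{2p}\\ \vdots&\vdots&\ddots&\vdots\\ C_{1p}^\top&C_{2p}^\top&\cdots&\Sigma_p\end{bmatrix}\right)$$ on $\mathbb R^{dp}$, where the matrices $C_{ij}\in\mathbb R^{d\times d}$, $1\le i<j\le p$, solve the semidefinite program $$\max_{\{C_{ij}\}}\ \sum_{i=1}^p\sum_{j=i+1}^p\operatorname{tr}(C_{ij})\quad\text{subject to}\quad \Sigma:=\begin{bmatrix}\Sigma_1&C_{12}&\cdots&C_{1p}\\ C_{12}^\top&\Sigma_2&\cdots&C_{2p}\\ \vdots&\vdots&\ddots&\vdots\\ C_{1p}^\top&C_{2p}^\top&\cdots&\Sigma_p\end{bmatrix}\succeq0 .$$ The solution of this semidefinite program exists, is unique, and satisfies $\operatorname{rank}(\Sigma)=d$.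
   Context: $\Pi(\mu_1,\dots,\mu_p)$ is the set of Borel probability measures on $(\mathbb R^d)^p$ whose $i$th marginal is $\mu_i$ for each $i$. $\succ0$ and $\succeq0$ mean symmetric positive definite and symmetric positive semidefinite. $\mathcal N(m,\Sigma)$ is the (possibly degenerate) Gaussian measure with mean $m$ and covariance matrix $\Sigma$. *)

theory Defs
  imports "HOL-Probability.Probability"
begin

definition pos_semidef :: "real^'n^'n \<Rightarrow> bool" where
  "pos_semidef A \<longleftrightarrow> transpose A = A \<and> (\<forall>x. 0 \<le> x \<bullet> (A *v x))"

definition pos_def :: "real^'n^'n \<Rightarrow> bool" where
  "pos_def A \<longleftrightarrow> transpose A = A \<and> (\<forall>x. x \<noteq> 0 \<longrightarrow> 0 < x \<bullet> (A *v x))"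

definition std_gaussian :: "(real^'n) measure" where
  "std_gaussian = density lborel (\<lambda>x. ennreal (\<Prod>k\<in>UNIV. std_normal_density (x $ k)))"

(* The law of m + A Z, with Z standard Gaussian and A any square matrix with A A^T = S.
   Such an A exists exactly when S is positive semidefinite (singular S is allowed), and by
   rotation invariance of the standard Gaussian the law depends on A only through A A^T.
   For S that is not positive semidefinite the value is meaningless. *)
definition gaussian :: "real^'n \<Rightarrow> real^'n^'n \<Rightarrow> (real^'n) measure" where
  "gaussian m S =
     distr std_gaussian borel (\<lambda>z. m + (SOME A :: real^'n^'n. A ** transpose A = S) *v z)"

(* The finite linearly ordered type 'p plays the role of {1,...,p}, and (real^'d)^'p that of
   (R^d)^p; R^{dp} is real^('p \<times> 'd), where coordinate (i, k) is the k-th entry of block i. *)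

definition couplings :: "('p::finite \<Rightarrow> (real^'d) measure) \<Rightarrow> ((real^'d)^'p) measure set" where
  "couplings \<mu> = {\<pi>. sets \<pi> = sets borel \<and> prob_space \<pi> \<and>
                     (\<forall>i. distr \<pi> borel (\<lambda>x. x $ i) = \<mu> i)}"

definition transport_cost :: "((real^'d)^'p::{finite,linorder}) measure \<Rightarrow> ennreal" where
  "transport_cost \<pi> =
     (\<integral>\<^sup>+ x. ennreal (\<Sum>i\<in>UNIV. \<Sum>j\<in>{i<..}. (norm (x $ i - x $ j))\<^sup>2) \<partial>\<pi>)"

definition optimal_plan ::
    "('p::{finite,linorder} \<Rightarrow> (real^'d) measure) \<Rightarrow> ((real^'d)^'p::{finite,linorder}) measure \<Rightarrow> bool" where
  "optimal_plan \<mu> \<pi> \<longleftrightarrow>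
     \<pi> \<in> couplings \<mu> \<and> (\<forall>\<pi>' \<in> couplings \<mu>. transport_cost \<pi> \<le> transport_cost \<pi>')"

definition stack :: "('p::finite \<Rightarrow> real^'d) \<Rightarrow> real^('p \<times> 'd)" where
  "stack m = (\<chi> a. m (fst a) $ snd a)"

definition unstack :: "real^('p::finite \<times> 'd) \<Rightarrow> (real^'d)^'p" where
  "unstack x = (\<chi> i. \<chi> k. x $ (i, k))"

definition block_matrix :: "('p::finite \<Rightarrow> 'p \<Rightarrow> real^'d^'d) \<Rightarrow> real^('p \<times> 'd)^('p \<times> 'd)" where
  "block_matrix B = (\<chi> a b. B (fst a) (fst b) $ snd a $ snd b)"

(* Only the values C i j with i < j are used. *)
definition cov_matrix ::
    "('p::{finite,linorder} \<Rightarrow> real^'d^'d) \<Rightarrow> ('p \<Rightarrow> 'p \<Rightarrow> real^'d^'d) \<Rightarrow>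
     real^('p \<times> 'd)^('p \<times> 'd)" where
  "cov_matrix S C = block_matrix (\<lambda>i j.
     if i = j then S i else if i < j then C i j else transpose (C j i))"

definition sdp_objective :: "('p::{finite,linorder} \<Rightarrow> 'p \<Rightarrow> real^'d^'d) \<Rightarrow> real" where
  "sdp_objective C = (\<Sum>i\<in>UNIV. \<Sum>j\<in>{i<..}. trace (C i j))"

definition sdp_solution ::
    "('p::{finite,linorder} \<Rightarrow> real^'d^'d) \<Rightarrow> ('p \<Rightarrow> 'p \<Rightarrow> real^'d^'d) \<Rightarrow> bool" where
  "sdp_solution S C \<longleftrightarrow>
     pos_semidef (cov_matrix S C) \<and>
     (\<forall>C'. pos_semidef (cov_matrix S C') \<longrightarrow> sdp_objective C' \<le> sdp_objective C)"

end

theory Submission imports Defs begin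

text \<open>If \<open>A i\<close> are square with \<open>A i ** transpose (A i) = S i\<close> and maximise the norm of
  \<open>s = (\<Sum>i. A i)\<close>, then \<open>s = M i ** A i\<close> with \<open>M i\<close> positive definite, and the inverses
  \<open>T i\<close> of \<open>M i\<close> sum up to the identity. Hence
  \<open>(\<Sum>i. x i \<bullet> (M i *v x i)) - \<bar>\<Sum>i. x i\<bar>\<^sup>2\<close> is nonnegative, and zero exactly if
  \<open>x i = T i *v (\<Sum>j. x j)\<close> for all \<open>i\<close>. Up to terms fixed by the marginals this form is the
  transport cost, and summed over the columns of a factor of the block matrix it is, up to sign, twice the
  objective of the semidefinite program. So both problems are solved precisely by what is
  concentrated on the \<open>d\<close>-dimensional subspace \<open>x i = T i *v y\<close>, which together with any
  single marginal determines the solution.\<close>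

section \<open>Matrices\<close>

text \<open>Stationarity under rotations is the common tool: compactness supplies a maximiser, and
  testing it against Householder reflections and products of two of them turns maximality into
  positivity of a matrix. This yields the certificate, and it also yields the fact that two square
  factors of the same Gram matrix differ by an orthogonal matrix. That fact is forced by the
  definition of \<open>gaussian\<close>, which picks an arbitrary square factor of a possibly
  singular covariance, whereas the optimal plan is naturally the law of \<open>m + F *v z\<close>
  with a tall factor \<open>F\<close> of only d columns. So the law must be shown independent of the
  factor, and tall factors must be padded to square ones.

  On the transport side the competitors are arbitrary couplings, of which only the marginals are
  known. The certificate is therefore applied pointwise to the cost, not to covariance matrices, and
  its equality case identifies the whole measure and not just its second moments.\<close>

lemma inner_eq_trace: "A \<bullet> B = trace (transpose A ** B)" for A B :: "real^'n^'m"
  unfolding trace_def transpose_def matrix_matrix_mult_def inner_vec_def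
  by (simp) (rule sum.swap)

lemma inner_eq_trace_transpose: "A \<bullet> B = trace (A ** transpose B)" for A B :: "real^'n^'m"
  by (metis inner_commute inner_eq_trace trace_mul_sym)

lemma inner_matrix_mult_left: "(A ** X) \<bullet> B = X \<bullet> (transpose A ** B)"
  for A :: "real^'n^'m" and X :: "real^'k^'n"
  by (simp add: inner_eq_trace matrix_transpose_mul matrix_mul_assoc)

lemma inner_transpose: "transpose A \<bullet> transpose B = A \<bullet> B" for A B :: "real^'n^'m"
  by (metis inner_commute inner_eq_trace trace_mul_sym transpose_transpose)

lemma inner_matrix_columns: "A \<bullet> B = (\<Sum>j\<in>UNIV. column j A \<bullet> column j B)" for A B :: "real^'n^'m"
  unfolding inner_vec_def column_def by (simp) (rule sum.swap)

lemma column_matrix_mult: "column j (A ** B) = A *v column j B"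
  by (simp add: vec_eq_iff column_def matrix_matrix_mult_def matrix_vector_mult_def)

lemma inner_matrix_vector: "x \<bullet> (A *v y) = (transpose A *v x) \<bullet> y" for A :: "real^'n^'m"
  by (simp add: dot_lmul_matrix)

lemma matrix_eqI_columns: "(\<And>j. column j A = column j B) \<Longrightarrow> A = B"
  by (simp add: vec_eq_iff column_def)

lemma transpose_add: "transpose (A + B) = transpose A + transpose B"
  by (simp add: vec_eq_iff transpose_def)

lemma transpose_diff: "transpose (A - B) = transpose A - transpose B"
  by (simp add: vec_eq_iff transpose_def)

lemma matrix_mult_sum_left: "(\<Sum>i\<in>I. A i) ** B = (\<Sum>i\<in>I. A i ** B)" for B :: "real^'k^'n"
  by (simp add: vec_eq_iff matrix_matrix_mult_def sum_distrib_right sum.swap[of _ _ I])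

lemma matrix_add_rdistrib: "(B + C) ** A = B ** A + C ** A" for A :: "real^'k^'n"
  by (simp add: vec_eq_iff matrix_matrix_mult_def sum.distrib algebra_simps)

lemma matrix_diff_ldistrib: "A ** (B - C) = A ** B - A ** C" for A :: "real^'k^'n"
  by (simp add: vec_eq_iff matrix_matrix_mult_def sum_subtractf algebra_simps)

lemma matrix_diff_rdistrib: "(B - C) ** A = B ** A - C ** A" for A :: "real^'k^'n"
  by (simp add: vec_eq_iff matrix_matrix_mult_def sum_subtractf algebra_simps)

lemma matrix_vector_mult_sum_left: "(\<Sum>i\<in>I. A i) *v x = (\<Sum>i\<in>I. A i *v x)" for x :: "real^'n"
  by (simp add: vec_eq_iff matrix_vector_mult_def sum_distrib_right sum.swap[of _ _ I])

lemma matrix_scaleR_left: "(c *\<^sub>R A) ** B = c *\<^sub>R (A ** B)" for A :: "real^'k^'n"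
  by (simp add: vec_eq_iff matrix_matrix_mult_def sum_distrib_left mult_ac)

lemma matrix_scaleR_right: "A ** (c *\<^sub>R B) = c *\<^sub>R (A ** B)" for A :: "real^'k^'n"
  by (simp add: vec_eq_iff matrix_matrix_mult_def sum_distrib_left mult_ac)

text \<open>For small \<open>t\<close> of the sign of \<open>a\<close> the linear term beats the
  quadratic one. This replaces differentiation at \<open>t = 0\<close> in the variational
  arguments.\<close>

lemma linear_dominated_by_square_imp_zero:
  fixes a b :: real
  assumes "\<And>t. t * a \<le> t\<^sup>2 * b"
  shows "a = 0"
proof (rule ccontr)
  assume "a \<noteq> 0"
  define t where "t = a / (\<bar>b\<bar> + 1)"
  have "t * a = a\<^sup>2 / (\<bar>b\<bar> + 1)" by (simp add: t_def power2_eq_square)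
  moreover have "t\<^sup>2 * b \<le> t\<^sup>2 * \<bar>b\<bar>" by (intro mult_left_mono) auto
  moreover have "t\<^sup>2 * \<bar>b\<bar> < t\<^sup>2 * (\<bar>b\<bar> + 1)"
    using \<open>a \<noteq> 0\<close> by (intro mult_strict_left_mono) (auto simp: t_def)
  moreover have "t\<^sup>2 * (\<bar>b\<bar> + 1) = a\<^sup>2 / (\<bar>b\<bar> + 1)"
    by (simp add: t_def power2_eq_square)
  ultimately show False using assms[of t] by linarith
qed

subsection \<open>Positive semidefinite matrices\<close>

lemma pos_semidefD:
  assumes "pos_semidef P"
  shows "transpose P = P" "0 \<le> x \<bullet> (P *v x)" "x \<bullet> (P *v y) = y \<bullet> (P *v x)"
proof -
  show "transpose P = P" "0 \<le> x \<bullet> (P *v x)" using assms by (auto simp: pos_semidef_def)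
  then show "x \<bullet> (P *v y) = y \<bullet> (P *v x)"
    by (metis inner_matrix_vector inner_commute)
qed

text \<open>At \<open>x\<close> the quadratic form attains its minimum 0, so its first variation in
  every direction \<open>y\<close> vanishes.\<close>

lemma pos_semidef_kernel:
  assumes P: "pos_semidef P" and "x \<bullet> (P *v x) = 0"
  shows "P *v x = 0"
proof -
  have "y \<bullet> (P *v x) = 0" for y
  proof (rule linear_dominated_by_square_imp_zero[where b = "(y \<bullet> (P *v y)) / 2"])
    fix t
    have "0 \<le> (x - t *\<^sub>R y) \<bullet> (P *v (x - t *\<^sub>R y))" by (rule pos_semidefD[OF P])
    then show "t * (y \<bullet> (P *v x)) \<le> t\<^sup>2 * ((y \<bullet> (P *v y)) / 2)"
      using assms(2) pos_semidefD(3)[OF P, of x y]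
      by (simp add: algebra_simps inner_diff_left inner_diff_right power2_eq_square)
  qed
  from this[of "P *v x"] show ?thesis by simp
qed

lemma inner_matrix_mult_pos_semidef:
  assumes P: "pos_semidef P"
  shows "0 \<le> D \<bullet> (P ** D)" and "D \<bullet> (P ** D) = 0 \<Longrightarrow> P ** D = 0"
proof -
  have eq: "D \<bullet> (P ** D) = (\<Sum>j\<in>UNIV. column j D \<bullet> (P *v column j D))"
    by (simp add: inner_matrix_columns column_matrix_mult)
  show "0 \<le> D \<bullet> (P ** D)"
    unfolding eq by (intro sum_nonneg pos_semidefD[OF P])
  assume "D \<bullet> (P ** D) = 0"
  then have "\<forall>j. column j D \<bullet> (P *v column j D) = 0"
    unfolding eq by (subst (asm) sum_nonneg_eq_0_iff) (auto intro: pos_semidefD[OF P])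
  then show "P ** D = 0"
    using pos_semidef_kernel[OF P]
    by (intro matrix_eqI_columns) (simp add: column_matrix_mult, simp add: column_def vec_eq_iff)
qed

text \<open>With \<open>D = P - Q\<close> one has \<open>P D + D Q = 0\<close>, so the nonnegative numbers
  \<open>tr (D P D)\<close> and \<open>tr (D Q D)\<close> add up to \<open>0\<close>.\<close>

lemma pos_semidef_square_inj:
  assumes P: "pos_semidef P" and Q: "pos_semidef Q" and eq: "P ** P = Q ** Q"
  shows "P = Q"
proof -
  define D where "D = P - Q"
  have tD: "transpose D = D"
    using P Q by (simp add: D_def transpose_diff pos_semidef_def)
  have "P ** D + D ** Q = 0"
    by (simp add: D_def matrix_diff_ldistrib matrix_diff_rdistrib eq)
  then have "D \<bullet> (P ** D) + D \<bullet> (D ** Q) = 0"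
    by (metis inner_add_right inner_zero_right)
  moreover have "D \<bullet> (D ** Q) = D \<bullet> (Q ** D)"
    by (metis Q inner_transpose matrix_transpose_mul pos_semidefD(1) tD)
  ultimately have "D \<bullet> (P ** D) = 0" "D \<bullet> (Q ** D) = 0"
    using inner_matrix_mult_pos_semidef(1)[OF P, of D] inner_matrix_mult_pos_semidef(1)[OF Q, of D]
    by linarith+
  then have "P ** D = 0" "Q ** D = 0"
    using inner_matrix_mult_pos_semidef(2)[OF P] inner_matrix_mult_pos_semidef(2)[OF Q] by auto
  then have "D ** D = 0" by (simp add: D_def matrix_diff_rdistrib)
  then have "D \<bullet> D = 0" by (metis inner_eq_trace tD trace_0 mat_0)
  then show ?thesis by (simp add: D_def)
qed

definition outer :: "real^'m \<Rightarrow> real^'n \<Rightarrow> real^'n^'m" where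
  "outer u v = (\<chi> i j. u $ i * v $ j)"

lemma outer_mult_vector: "outer u v *v x = (v \<bullet> x) *\<^sub>R u"
  by (simp add: vec_eq_iff outer_def matrix_vector_mult_def inner_vec_def sum_distrib_left
      sum_distrib_right mult_ac)

lemma inner_outer: "outer u v \<bullet> W = u \<bullet> (W *v v)"
  by (simp add: outer_def inner_vec_def matrix_vector_mult_def sum_distrib_left mult_ac)

lemma outer_0 [simp]: "outer 0 v = 0" "outer v 0 = 0"
  by (simp_all add: vec_eq_iff outer_def)

lemma transpose_outer: "transpose (outer u v) = outer v u"
  by (simp add: vec_eq_iff outer_def transpose_def)

lemma outer_mult_outer: "outer u v ** outer w z = (v \<bullet> w) *\<^sub>R outer u z"
  by (simp add: vec_eq_iff outer_def matrix_matrix_mult_def inner_vec_def sum_distrib_left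
      sum_distrib_right mult_ac)

text \<open>Symmetric Gaussian elimination: each step subtracts the rank-one matrix built from the
  pivot column. The Schur complement stays positive semidefinite, gains \<open>axis k 1\<close> in
  its kernel and keeps the basis vectors already there. Once all coordinates are treated the
  remainder is 0 and the vectors \<open>v k\<close> are the columns of a factor.\<close>

lemma pos_semidef_peel:
  fixes S :: "real^'n^'n"
  assumes "pos_semidef S" "finite I"
  shows "\<exists>v. pos_semidef (S - (\<Sum>k\<in>I. outer (v k) (v k))) \<and>
             (\<forall>k\<in>I. (S - (\<Sum>k\<in>I. outer (v k) (v k))) *v axis k 1 = 0)"
  using assms(2)
proof (induction I)
  case empty
  then show ?case using assms(1) by simp
next
  case (insert k I)
  then obtain v where v: "pos_semidef (S - (\<Sum>k\<in>I. outer (v k) (v k)))"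
    "\<forall>k\<in>I. (S - (\<Sum>k\<in>I. outer (v k) (v k))) *v axis k 1 = 0" by blast
  define R where "R = S - (\<Sum>k\<in>I. outer (v k) (v k))"
  have R: "pos_semidef R" and RI: "\<And>j. j \<in> I \<Longrightarrow> R *v axis j 1 = 0" using v by (auto simp: R_def)
  define e where "e = (axis k 1 :: real^'n)"
  define r where "r = e \<bullet> (R *v e)"
  \<comment> \<open>A zero pivot makes \<open>u\<close> zero through division by zero. This is the
    right value, since then \<open>R *v e = 0\<close> by \<open>pos_semidef_kernel\<close> and
    nothing has to be removed.\<close>
  define u where "u = (1 / sqrt r) *\<^sub>R (R *v e)"
  have r0: "r \<ge> 0" unfolding r_def by (rule pos_semidefD[OF R])
  have ux: "u \<bullet> x = (e \<bullet> (R *v x)) / sqrt r" for x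
    using pos_semidefD(3)[OF R, of x e] by (simp add: u_def inner_commute)
  have R'x: "(R - outer u u) *v x = R *v x - (u \<bullet> x) *\<^sub>R u" for x
    by (simp add: matrix_vector_mult_diff_rdistrib outer_mult_vector)
  have "transpose (R - outer u u) = R - outer u u"
    using R by (simp add: transpose_diff transpose_outer pos_semidef_def)
  moreover have "0 \<le> x \<bullet> ((R - outer u u) *v x)" for x
  proof (cases "r = 0")
    case True
    then show ?thesis using pos_semidefD(2)[OF R, of x] by (simp add: R'x u_def)
  next
    case False
    \<comment> \<open>\<open>c\<close> minimises the quadratic form along
      \<open>x - c *\<^sub>R e\<close>; its minimal value is the form of the Schur complement at
      \<open>x\<close>.\<close>
    define c where "c = (e \<bullet> (R *v x)) / r"
    have "0 \<le> (x - c *\<^sub>R e) \<bullet> (R *v (x - c *\<^sub>R e))" by (rule pos_semidefD[OF R])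
    also have "\<dots> = x \<bullet> (R *v x) - 2 * c * (e \<bullet> (R *v x)) + c * c * r"
      using pos_semidefD(3)[OF R, of x e]
      by (simp add: algebra_simps inner_diff_left inner_diff_right r_def)
    also have "\<dots> = x \<bullet> (R *v x) - (u \<bullet> x) * (u \<bullet> x)"
      using False r0 by (simp add: ux c_def field_simps power2_eq_square)
    finally show ?thesis by (simp add: R'x inner_diff_right inner_commute)
  qed
  ultimately have psd: "pos_semidef (R - outer u u)" by (simp add: pos_semidef_def)
  have "(R - outer u u) *v axis j 1 = 0" if "j \<in> insert k I" for j
  proof (cases "j = k")
    case True
    show ?thesis
    proof (cases "r = 0")
      case True
      then have "R *v e = 0" using pos_semidef_kernel[OF R] by (simp add: r_def)
      then show ?thesis using \<open>j = k\<close> by (simp add: R'x u_def e_def)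
    next
      case False
      then have "(u \<bullet> e) *\<^sub>R u = R *v e"
        using r0 by (simp add: ux r_def[symmetric]) (simp add: u_def)
      then show ?thesis using \<open>j = k\<close> by (simp add: R'x e_def)
    qed
  next
    case False
    then show ?thesis using that RI by (simp add: R'x ux)
  qed
  moreover have "S - (\<Sum>j\<in>insert k I. outer ((v(k := u)) j) ((v(k := u)) j)) = R - outer u u"
    using insert.hyps by (simp add: R_def fun_upd_def algebra_simps)
      (intro sum.cong, auto)
  ultimately show ?case using psd by (intro exI[of _ "v(k := u)"]) metis
qed

lemma pos_semidef_factor:
  fixes S :: "real^'n^'n"
  assumes "pos_semidef S"
  shows "\<exists>A :: real^'n^'n. A ** transpose A = S"
proof -
  obtain v :: "'n \<Rightarrow> real^'n" where v: "\<forall>k. (S - (\<Sum>k\<in>UNIV. outer (v k) (v k))) *v axis k 1 = 0"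
    using pos_semidef_peel[OF assms finite_class.finite_UNIV] by auto
  then have "S - (\<Sum>k\<in>UNIV. outer (v k) (v k)) = 0"
    by (intro matrix_eqI_columns) (auto simp: matrix_vector_mult_basis column_def vec_eq_iff)
  then have "(\<chi> i k. v k $ i) ** transpose (\<chi> i k. v k $ i) = S"
    by (simp add: vec_eq_iff matrix_matrix_mult_def transpose_def outer_def)
  then show ?thesis by blast
qed

lemma pos_semidef_gram: "pos_semidef (A ** transpose A)" for A :: "real^'n^'m"
  by (auto simp: pos_semidef_def matrix_transpose_mul matrix_vector_mul_assoc[symmetric]
      inner_matrix_vector[of _ A] simp del: transpose_matrix_vector)

subsection \<open>Maximisation over orthogonal matrices\<close>

definition householder :: "real^'n \<Rightarrow> real^'n^'n" where
  "householder u = mat 1 - (2 / (u \<bullet> u)) *\<^sub>R outer u u"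

lemma orthogonal_householder: "orthogonal_matrix (householder u)"
proof -
  have h: "householder u *v x = x - (2 / (u \<bullet> u) * (u \<bullet> x)) *\<^sub>R u" for x
    by (simp add: householder_def matrix_vector_mult_diff_rdistrib outer_mult_vector
        scaleR_matrix_vector_assoc[symmetric])
  have "transpose (householder u) = householder u"
    by (simp add: householder_def transpose_diff transpose_outer transpose_scalar)
  moreover have "householder u *v (householder u *v x) = x" for x
  proof (cases "u = 0")
    case False
    then have "2 / (u \<bullet> u) * (u \<bullet> (x - (2 / (u \<bullet> u) * (u \<bullet> x)) *\<^sub>R u)) = - (2 / (u \<bullet> u) * (u \<bullet> x))"
      by (simp add: inner_diff_right field_simps)
    then show ?thesis by (simp add: h)
  next
    case True
    then show ?thesis using h by simp
  qed
  ultimately show ?thesis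
    by (simp add: orthogonal_matrix matrix_eq matrix_vector_mul_assoc[symmetric])
qed

text \<open>Testing against one Householder reflection gives nonnegativity of the quadratic form;
  testing against the product of the reflections in \<open>u\<close> and in \<open>u + t h\<close> gives, to first order
  in \<open>t\<close>, the symmetry.\<close>

lemma max_over_orthogonal_imp_pos_semidef:
  fixes W :: "real^'n^'n"
  assumes max: "\<And>Q. orthogonal_matrix Q \<Longrightarrow> Q \<bullet> W \<le> mat 1 \<bullet> W"
  shows "pos_semidef W"
proof -
  define w where "w u v = u \<bullet> (W *v v)" for u v
  have nonneg: "0 \<le> w u u" for u
  proof (cases "u = 0")
    case False
    then have "0 \<le> 2 / (u \<bullet> u) * w u u"
      using max[OF orthogonal_householder[of u]]
      by (simp add: householder_def inner_diff_left inner_outer w_def)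
    then show ?thesis using False
      by (metis divide_pos_pos inner_gt_zero_iff zero_le_mult_iff zero_less_numeral not_le)
  qed (simp add: w_def)
  have two: "2 * (u \<bullet> v) * w u v \<le> (v \<bullet> v) * w u u + (u \<bullet> u) * w v v" for u v
  proof (cases "u = 0 \<or> v = 0")
    case False
    define a b where "a = u \<bullet> u" and "b = v \<bullet> v"
    have ab: "a > 0" "b > 0" using False by (auto simp: a_def b_def)
    have "(householder u ** householder v) \<bullet> W =
        mat 1 \<bullet> W - 2 / a * w u u - 2 / b * w v v + (2 / a) * (2 / b) * (u \<bullet> v) * w u v"
      by (simp add: householder_def a_def b_def matrix_diff_ldistrib matrix_diff_rdistrib
          matrix_scaleR_left matrix_scaleR_right outer_mult_outer inner_diff_left inner_outer w_def diff_divide_distrib algebra_simps)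
    moreover have "(householder u ** householder v) \<bullet> W \<le> mat 1 \<bullet> W"
      by (intro max orthogonal_matrix_mul orthogonal_householder)
    ultimately have "(2 / a) * (2 / b) * (u \<bullet> v) * w u v \<le> 2 / a * w u u + 2 / b * w v v"
      by linarith
    then have "a * b / 2 * ((2 / a) * (2 / b) * (u \<bullet> v) * w u v) \<le> a * b / 2 * (2 / a * w u u + 2 / b * w v v)"
      using ab by (intro mult_left_mono) auto
    moreover have "a * b / 2 * ((2 / a) * (2 / b) * (u \<bullet> v) * w u v) = 2 * (u \<bullet> v) * w u v"
      "a * b / 2 * (2 / a * w u u + 2 / b * w v v) = b * w u u + a * w v v"
      using ab by (simp_all add: field_simps)
    ultimately show ?thesis by (simp add: a_def b_def)
  qed (auto simp: w_def)
  have "w u h = w h u" for u h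
  proof (cases "u = 0")
    case False
    have "(u \<bullet> u) * (w u h - w h u) = 0"
    proof (rule linear_dominated_by_square_imp_zero)
      fix t
      show "t * ((u \<bullet> u) * (w u h - w h u)) \<le>
          t\<^sup>2 * ((h \<bullet> h) * w u u + (u \<bullet> u) * w h h - 2 * (u \<bullet> h) * w u h)"
        using two[of u "u + t *\<^sub>R h"]
        by (simp add: w_def algebra_simps inner_add_left inner_add_right power2_eq_square inner_commute)
    qed
    then show ?thesis using False by simp
  qed (simp add: w_def)
  from this[of "axis _ 1" "axis _ 1"] have "transpose W = W"
    by (simp add: w_def vec_eq_iff transpose_def matrix_vector_mult_basis column_def inner_axis')
  then show ?thesis using nonneg by (simp add: pos_semidef_def w_def)
qed

section \<open>Compactness of the factors of a fixed matrix, and their uniqueness up to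
  rotation\<close>

lemma closed_gram_constraint:
  fixes S :: "real^'m^'m"
  shows "closed {A :: real^'n^'m. A ** transpose A = S}"
proof -
  have "{A :: real^'n^'m. A ** transpose A = S} =
      {A. \<forall>i j. (\<Sum>k\<in>UNIV. A $ i $ k * A $ j $ k) = S $ i $ j}"
    by (auto simp: vec_eq_iff matrix_matrix_mult_def transpose_def)
  then show ?thesis
    by (auto intro!: closed_Collect_all closed_Collect_eq continuous_intros)
qed

lemma norm_gram_constraint:
  fixes A :: "real^'n^'m"
  assumes "A ** transpose A = S"
  shows "norm A = sqrt (trace S)"
  using assms by (metis inner_eq_trace norm_eq_sqrt_inner trace_mul_sym)

lemma compact_gram_constraint: "compact {A :: real^'n^'m. A ** transpose A = S}"
proof -
  have "\<forall>A\<in>{A :: real^'n^'m. A ** transpose A = S}. norm A \<le> sqrt (trace S)"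
    by (metis (mono_tags, lifting) mem_Collect_eq norm_gram_constraint order_refl)
  then show ?thesis
    unfolding compact_eq_bounded_closed bounded_iff using closed_gram_constraint by blast
qed

lemma orthogonal_matrix_gram: "orthogonal_matrix Q \<longleftrightarrow> Q ** transpose Q = mat 1" for Q :: "real^'n^'n"
  using orthogonal_matrix_transpose[of Q] by (metis orthogonal_matrix transpose_transpose)

text \<open>Among all orthogonal \<open>Q\<close> choose the one for which \<open>A ** Q\<close> is closest to \<open>B\<close>; then
  \<open>transpose (A ** Q) ** B\<close> is positive semidefinite with square \<open>(transpose B ** B)\<^sup>2\<close>.\<close>

lemma same_gram_imp_orthogonal:
  fixes A B :: "real^'n^'m"
  assumes eq: "A ** transpose A = B ** transpose B"
  shows "\<exists>Q. orthogonal_matrix Q \<and> B = A ** Q"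
proof -
  have "\<exists>Q\<in>{Q :: real^'n^'n. Q ** transpose Q = mat 1}.
      \<forall>Q'\<in>{Q :: real^'n^'n. Q ** transpose Q = mat 1}. Q' \<bullet> (transpose A ** B) \<le> Q \<bullet> (transpose A ** B)"
    by (rule continuous_attains_sup[OF compact_gram_constraint])
       (auto intro!: continuous_intros exI[of _ "mat 1"])
  then obtain Q :: "real^'n^'n" where Q: "orthogonal_matrix Q"
    and max: "\<And>Q'. orthogonal_matrix Q' \<Longrightarrow> Q' \<bullet> (transpose A ** B) \<le> Q \<bullet> (transpose A ** B)"
    by (auto simp: orthogonal_matrix_gram)
  define A' where "A' = A ** Q"
  have QQ: "Q ** transpose Q = mat 1" using Q by (simp add: orthogonal_matrix_gram)
  have gram: "A' ** transpose A' = B ** transpose B"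
    by (simp add: A'_def matrix_transpose_mul eq[symmetric])
       (metis QQ matrix_mul_assoc matrix_mul_rid)
  define W where "W = transpose A' ** B"
  have "pos_semidef W"
  proof (rule max_over_orthogonal_imp_pos_semidef)
    fix O' :: "real^'n^'n" assume "orthogonal_matrix O'"
    then have "(Q ** O') \<bullet> (transpose A ** B) \<le> Q \<bullet> (transpose A ** B)"
      by (intro max orthogonal_matrix_mul Q)
    then show "O' \<bullet> W \<le> mat 1 \<bullet> W"
      using inner_matrix_mult_left[of Q "mat 1" "transpose A ** B"]
      by (simp add: W_def A'_def matrix_transpose_mul inner_matrix_mult_left matrix_mul_assoc)
  qed
  moreover have psdB: "pos_semidef (transpose B ** B)"
    using pos_semidef_gram[of "transpose B"] by simp
  moreover have "W ** W = (transpose B ** B) ** (transpose B ** B)"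
  proof -
    have "W ** W = transpose W ** W" using \<open>pos_semidef W\<close> by (simp add: pos_semidef_def)
    also have "\<dots> = transpose B ** (A' ** transpose A') ** B"
      by (simp add: W_def matrix_transpose_mul matrix_mul_assoc)
    finally show ?thesis by (simp add: gram matrix_mul_assoc)
  qed
  ultimately have W: "W = transpose B ** B" by (rule pos_semidef_square_inj)
  \<comment> \<open>The norms agree because the Gram matrices do, and the inner product is the trace
    of \<open>W\<close>, now known to be the squared norm of \<open>B\<close>. So the distance from
    \<open>A'\<close> to \<open>B\<close> is 0.\<close>
  have "A' \<bullet> A' = B \<bullet> B"
    using norm_gram_constraint[OF gram] norm_gram_constraint[of B] by (metis dot_square_norm)
  moreover have "A' \<bullet> B = B \<bullet> B"
    using W by (simp add: inner_eq_trace W_def)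
  ultimately have "(A' - B) \<bullet> (A' - B) = 0"
    by (simp add: inner_diff_left inner_diff_right inner_commute)
  then show ?thesis using Q by (auto simp: A'_def)
qed

section \<open>The semidefinite program\<close>

lemma pos_def_imp_pos_semidef: "pos_def S \<Longrightarrow> pos_semidef S"
  unfolding pos_def_def pos_semidef_def
  by (metis inner_zero_left less_eq_real_def)

lemma pos_def_invertible: "pos_def S \<Longrightarrow> invertible S"
  unfolding invertible_left_inverse matrix_left_invertible_ker pos_def_def
  by (metis inner_zero_right less_irrefl)

lemma column_sum: "column j (\<Sum>i\<in>I. G i) = (\<Sum>i\<in>I. column j (G i))"
  by (simp add: vec_eq_iff column_def)

lemma column_diff: "column j (A - B) = column j A - column j B"
  by (simp add: vec_eq_iff column_def)

definition stack_rows :: "('p::finite \<Rightarrow> real^'n^'d) \<Rightarrow> real^'n^('p \<times> 'd)" where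
  "stack_rows A = (\<chi> a. A (fst a) $ snd a)"

lemma stack_rows_mult: "(stack_rows A *v z) $ (i, k) = (A i *v z) $ k"
  by (simp add: stack_rows_def matrix_vector_mult_def)

text \<open>In dual terms the \<open>M i\<close> are multipliers for the prescribed diagonal blocks:
  \<open>\<Sum>i. trace (M i ** S i)\<close> bounds the sum of all block traces, with equality at
  \<open>A\<close>. In terms of barycenters, with p marginals, \<open>p *\<^sub>R T i\<close> is the
  linear optimal map from the centred Gaussian with factor \<open>s /\<^sub>R p\<close> to the one
  with covariance \<open>S i\<close>, and \<open>sum_T\<close> is the fixed-point equation saying
  that these maps average to the identity.\<close>

locale barycentric_certificate =
  fixes S A M T :: "'p::finite \<Rightarrow> real^'d^'d" and s :: "real^'d^'d"
  assumes gram: "A i ** transpose (A i) = S i"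
    and invertible_A: "invertible (A i)"
    and pos_def_M: "pos_def (M i)"
    and MT: "M i ** T i = mat 1" and TM: "T i ** M i = mat 1"
    and MA: "M i ** A i = s"
    and sum_A: "(\<Sum>i\<in>UNIV. A i) = s"
    and sum_T: "(\<Sum>i\<in>UNIV. T i) = mat 1"

lemma compact_gram_family:
  fixes S :: "'p::finite \<Rightarrow> real^'m^'m"
  shows "compact {A :: (real^'n^'m)^'p. \<forall>i. A $ i ** transpose (A $ i) = S i}" (is "compact ?K")
proof -
  have "norm A \<le> (\<Sum>i\<in>UNIV. sqrt (trace (S i)))" if "A \<in> ?K" for A
  proof -
    have "norm A \<le> (\<Sum>i\<in>UNIV. norm (A $ i))"
      unfolding norm_vec_def[of A] by (rule L2_set_le_sum) auto
    also have "\<dots> = (\<Sum>i\<in>UNIV. sqrt (trace (S i)))"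
      using that by (intro sum.cong refl norm_gram_constraint) auto
    finally show ?thesis .
  qed
  then have "bounded ?K" unfolding bounded_iff by blast
  moreover have "?K = (\<Inter>i. (\<lambda>A. A $ i) -` {B. B ** transpose B = S i})" by auto
  moreover have "closed (\<Inter>i. (\<lambda>A :: (real^'n^'m)^'p. A $ i) -` {B. B ** transpose B = S i})"
    by (intro closed_INT ballI continuous_closed_vimage closed_gram_constraint continuous_intros)
  ultimately show ?thesis by (simp add: compact_eq_bounded_closed)
qed

text \<open>Maximise the norm of \<open>\<Sum>i. A i\<close> over all factors with \<open>A i ** transpose (A i) = S i\<close>.
  Optimality under \<open>A i \<mapsto> A i ** Q\<close> says that \<open>transpose (A i) ** (\<Sum>j\<noteq>i. A j)\<close> is positive
  semidefinite, i.e. that \<open>(\<Sum>j\<noteq>i. A j) = N ** A i\<close> with \<open>N\<close> positive semidefinite;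
  then \<open>M i = N + mat 1\<close> is positive definite.\<close>

lemma barycentric_certificate_exists:
  fixes S :: "'p::finite \<Rightarrow> real^'d^'d"
  assumes pd: "\<And>i. pos_def (S i)"
  shows "\<exists>A M T s. barycentric_certificate S A M T s"
proof -
  let ?K = "{A :: (real^'d^'d)^'p. \<forall>i. A $ i ** transpose (A $ i) = S i}"
  let ?F = "\<lambda>A :: (real^'d^'d)^'p. (\<Sum>i\<in>UNIV. A $ i) \<bullet> (\<Sum>i\<in>UNIV. A $ i)"
  have "\<exists>A0\<in>?K. \<forall>A\<in>?K. ?F A \<le> ?F A0"
  proof (rule continuous_attains_sup[OF compact_gram_family])
    have "\<forall>i. \<exists>A :: real^'d^'d. A ** transpose A = S i"
      using pos_semidef_factor pd pos_def_imp_pos_semidef by blast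
    then obtain R :: "'p \<Rightarrow> real^'d^'d" where "\<forall>i. R i ** transpose (R i) = S i" by metis
    then have "(\<chi> i. R i) \<in> ?K" by simp
    then show "?K \<noteq> {}" by blast
  qed (intro continuous_intros)
  then obtain A0 where A0: "A0 \<in> ?K" and max: "\<And>A. A \<in> ?K \<Longrightarrow> ?F A \<le> ?F A0" by blast
  define A where "A i = A0 $ i" for i
  define s where "s = (\<Sum>i\<in>UNIV. A i)"
  have gram: "A i ** transpose (A i) = S i" for i using A0 by (simp add: A_def)
  have W: "pos_semidef (transpose (A i) ** (s - A i))" for i
  proof (rule max_over_orthogonal_imp_pos_semidef)
    fix Q :: "real^'d^'d" assume Q: "orthogonal_matrix Q"
    define B where "B = s - A i"
    define A1 where "A1 = (\<chi> j. if j = i then A i ** Q else A j)"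
    have QQ: "Q ** transpose Q = mat 1" using Q by (simp add: orthogonal_matrix_gram)
    have gram': "(A i ** Q) ** transpose (A i ** Q) = S i"
      by (simp add: matrix_transpose_mul gram[symmetric]) (metis QQ matrix_mul_assoc matrix_mul_rid)
    then have "A1 \<in> ?K" by (auto simp: A1_def gram)
    moreover have "B = (\<Sum>j\<in>UNIV - {i}. A j)"
      using sum.remove[of UNIV i A] by (simp add: B_def s_def)
    then have "(\<Sum>j\<in>UNIV. A1 $ j) = A i ** Q + B"
      using sum.remove[of UNIV i "\<lambda>j. A1 $ j"] by (simp add: A1_def)
    ultimately have "(A i ** Q + B) \<bullet> (A i ** Q + B) \<le> (A i + B) \<bullet> (A i + B)"
      using max[of A1] by (simp add: A_def[symmetric] s_def[symmetric] B_def)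
    \<comment> \<open>Rotating one factor keeps its norm, so only the cross term with
      \<open>B\<close> remains in the comparison.\<close>
    moreover have "(A i ** Q) \<bullet> (A i ** Q) = A i \<bullet> A i"
      using norm_gram_constraint[OF gram'] norm_gram_constraint[OF gram[of i]] by (metis dot_square_norm)
    ultimately have "(A i ** Q) \<bullet> B \<le> A i \<bullet> B"
      by (simp add: inner_add_left inner_add_right inner_commute)
    then show "Q \<bullet> (transpose (A i) ** (s - A i)) \<le> mat 1 \<bullet> (transpose (A i) ** (s - A i))"
      using inner_matrix_mult_left[of "A i" "mat 1" B]
      by (simp add: inner_matrix_mult_left B_def)
  qed
  have invA: "invertible (A i)" for i
  proof -
    obtain S' where "S i ** S' = mat 1"
      using pos_def_invertible[OF pd] invertible_right_inverse by blast
    then show ?thesis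
      unfolding invertible_right_inverse gram[symmetric] by (metis matrix_mul_assoc)
  qed
  then have "\<forall>i. \<exists>R. A i ** R = mat 1 \<and> R ** A i = mat 1" by (simp add: invertible_def)
  then obtain R where AR: "\<And>i. A i ** R i = mat 1" and RA: "\<And>i. R i ** A i = mat 1" by metis
  \<comment> \<open>A congruence of a positive semidefinite matrix by \<open>R i\<close>, the
    inverse of \<open>A i\<close>. Since the two transposes cancel, it is just
    \<open>(s - A i) ** R i\<close>.\<close>
  define N where "N i = transpose (R i) ** (transpose (A i) ** (s - A i)) ** R i" for i
  define M where "M i = N i + mat 1" for i
  have "transpose (N i) = N i" for i
    using pos_semidefD(1)[OF W[of i]] unfolding N_def
    by (metis matrix_mul_assoc matrix_transpose_mul transpose_transpose)
  moreover have "x \<bullet> (N i *v x) \<ge> 0" for i x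
    using pos_semidefD(2)[OF W[of i], of "R i *v x"] unfolding N_def
    by (simp add: matrix_vector_mul_assoc[symmetric] inner_matrix_vector[of _ "transpose _"]
        del: transpose_matrix_vector)
  ultimately have pdM: "pos_def (M i)" for i
    by (simp add: pos_def_def M_def transpose_add matrix_vector_mult_add_rdistrib inner_add_right
        add_nonneg_pos)
  have "N i ** A i = s - A i" for i
  proof -
    have "N i ** A i = transpose (A i ** R i) ** (s - A i) ** (R i ** A i)"
      by (simp only: N_def matrix_transpose_mul matrix_mul_assoc)
    then show ?thesis by (simp add: AR RA)
  qed
  then have MA: "M i ** A i = s" for i
    by (simp add: M_def matrix_add_rdistrib)
  have "\<forall>i. \<exists>T. M i ** T = mat 1 \<and> T ** M i = mat 1"
    using pos_def_invertible[OF pdM] by (simp add: invertible_def)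
  then obtain T where MT: "\<And>i. M i ** T i = mat 1" and TM: "\<And>i. T i ** M i = mat 1" by metis
  \<comment> \<open>Invertibility of \<open>s\<close> is what allows it to be cancelled from
    \<open>(\<Sum>i. T i) ** s = s\<close>.\<close>
  have "invertible (M i ** A i)" for i
    by (intro invertible_mult pos_def_invertible pdM invA)
  then have "invertible s" by (simp add: MA)
  then obtain s' where s': "s ** s' = mat 1" by (auto simp: invertible_def)
  have "T i ** s = A i" for i by (metis MA TM matrix_mul_assoc matrix_mul_lid)
  then have "(\<Sum>i\<in>UNIV. T i) ** s = s" by (simp add: matrix_mult_sum_left s_def)
  then have "(\<Sum>i\<in>UNIV. T i) = mat 1" by (metis s' matrix_mul_assoc matrix_mul_rid)
  then have "barycentric_certificate S A M T s"
    using gram invA pdM MT TM MA by unfold_locales (auto simp: s_def)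
  then show ?thesis by blast
qed

context barycentric_certificate
begin

lemma A_eq: "A i = T i ** s"
  by (metis MA TM matrix_mul_assoc matrix_mul_lid)

text \<open>With \<open>y\<close> the sum of the \<open>x i\<close>, expanding the right-hand side
  and using \<open>M i *v (T i *v y) = y\<close> gives cross terms adding up to
  \<open>- 2 * (y \<bullet> y)\<close>, while the last terms add up to \<open>y \<bullet> y\<close>
  because the \<open>T i\<close> sum to the identity.\<close>

lemma complete_square:
  "(\<Sum>i\<in>UNIV. x i \<bullet> (M i *v x i)) - (\<Sum>i\<in>UNIV. x i) \<bullet> (\<Sum>i\<in>UNIV. x i) =
    (\<Sum>i\<in>UNIV. (x i - T i *v (\<Sum>j\<in>UNIV. x j)) \<bullet> (M i *v (x i - T i *v (\<Sum>j\<in>UNIV. x j))))"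
proof -
  define y where "y = (\<Sum>j\<in>UNIV. x j)"
  have MTy: "M i *v (T i *v y) = y" for i
    by (simp add: matrix_vector_mul_assoc MT)
  have "(x i - T i *v y) \<bullet> (M i *v (x i - T i *v y)) =
      x i \<bullet> (M i *v x i) - 2 * (x i \<bullet> y) + (T i *v y) \<bullet> y" for i
    using pos_semidefD(3)[OF pos_def_imp_pos_semidef[OF pos_def_M], of "T i *v y" i "x i"]
    by (simp add: matrix_vector_mult_diff_distrib MTy inner_diff_left inner_diff_right)
  then have "(\<Sum>i\<in>UNIV. (x i - T i *v y) \<bullet> (M i *v (x i - T i *v y))) =
      (\<Sum>i\<in>UNIV. x i \<bullet> (M i *v x i)) - 2 * (\<Sum>i\<in>UNIV. x i \<bullet> y) + (\<Sum>i\<in>UNIV. (T i *v y) \<bullet> y)"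
    by (simp add: sum.distrib sum_subtractf sum_distrib_left)
  moreover have "(\<Sum>i\<in>UNIV. (T i *v y) \<bullet> y) = y \<bullet> y"
    by (simp add: inner_sum_left[symmetric] matrix_vector_mult_sum_left[symmetric] sum_T)
  moreover have "(\<Sum>i\<in>UNIV. x i \<bullet> y) = y \<bullet> y"
    by (simp add: inner_sum_left[symmetric] y_def)
  ultimately show ?thesis by (simp add: y_def)
qed

lemma complete_square_matrix:
  fixes G :: "'p \<Rightarrow> real^'n^'d"
  shows "(\<Sum>i\<in>UNIV. G i \<bullet> (M i ** G i)) - (\<Sum>i\<in>UNIV. G i) \<bullet> (\<Sum>i\<in>UNIV. G i) =
    (\<Sum>i\<in>UNIV. (G i - T i ** (\<Sum>j\<in>UNIV. G j)) \<bullet> (M i ** (G i - T i ** (\<Sum>j\<in>UNIV. G j))))"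
    (is "?L = ?R")
proof -
  have "?L = (\<Sum>c\<in>UNIV. (\<Sum>i\<in>UNIV. column c (G i) \<bullet> (M i *v column c (G i))) -
      (\<Sum>i\<in>UNIV. column c (G i)) \<bullet> (\<Sum>i\<in>UNIV. column c (G i)))"
    by (simp add: inner_matrix_columns column_matrix_mult column_sum sum_subtractf) (rule sum.swap)
  also have "\<dots> = ?R"
    by (simp add: complete_square inner_matrix_columns column_matrix_mult column_sum column_diff)
       (rule sum.swap)
  finally show ?thesis .
qed

text \<open>An invertible block makes the tall factor injective and its transpose surjective, so the
  product has the same range as the factor.\<close>

lemma rank_stack_rows_gram: "rank (stack_rows A ** transpose (stack_rows A)) = CARD('d)"
proof -
  have inj: "inj ((*v) (stack_rows A))"
  proof (rule injI)
    fix x y assume "stack_rows A *v x = stack_rows A *v y"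
    then have "A i *v x = A i *v y" for i
      by (metis stack_rows_mult vec_eq_iff)
    then show "x = y" using invertible_A
      by (metis invertible_def matrix_vector_mul_assoc matrix_vector_mul_lid)
  qed
  have "surj ((*v) (transpose (stack_rows A)))"
    using inj by (metis full_rank_injective full_rank_surjective rank_transpose)
  then have "range ((*v) (stack_rows A ** transpose (stack_rows A))) = range ((*v) (stack_rows A))"
    by (simp add: matrix_vector_mul_assoc[symmetric] image_image[symmetric] del: transpose_matrix_vector)
  then show ?thesis
    using inj full_rank_injective[of "stack_rows A"] by (simp add: rank_dim_range)
qed

end

section \<open>Block matrices in factored form, and duality for the semidefinite program\<close>

definition block_row :: "real^'n^('p::finite \<times> 'd::finite) \<Rightarrow> 'p \<Rightarrow> real^'n^'d" where
  "block_row F i = (\<chi> k. F $ (i, k))"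

lemma block_matrix_eq_gram_iff:
  "block_matrix B = F ** transpose F \<longleftrightarrow> (\<forall>i j. B i j = block_row F i ** transpose (block_row F j))"
  by (simp add: block_matrix_def vec_eq_iff block_row_def matrix_matrix_mult_def transpose_def) blast

lemma sum_square_upper_triangle:
  fixes f :: "'p::{finite,linorder} \<Rightarrow> 'p \<Rightarrow> real"
  assumes sym: "\<And>i j. f i j = f j i"
  shows "(\<Sum>i\<in>UNIV. \<Sum>j\<in>UNIV. f i j) = (\<Sum>i\<in>UNIV. f i i) + 2 * (\<Sum>i\<in>UNIV. \<Sum>j\<in>{i<..}. f i j)"
proof -
  have "(\<Sum>j\<in>UNIV. f i j) = f i i + (\<Sum>j\<in>{i<..}. f i j) + (\<Sum>j\<in>{..<i}. f i j)" for i
  proof -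
    have "UNIV = insert i ({i<..} \<union> {..<i})" by auto
    then have "(\<Sum>j\<in>UNIV. f i j) = (\<Sum>j\<in>insert i ({i<..} \<union> {..<i}). f i j)" by simp
    also have "\<dots> = f i i + ((\<Sum>j\<in>{i<..}. f i j) + (\<Sum>j\<in>{..<i}. f i j))"
      by (subst sum.insert) (auto intro!: sum.union_disjoint)
    finally show ?thesis by simp
  qed
  moreover have "(\<Sum>i\<in>UNIV. \<Sum>j\<in>{..<i}. f i j) = (\<Sum>i\<in>UNIV. \<Sum>j\<in>{i<..}. f i j)"
    by (simp add: sum.Sigma)
       (rule sum.reindex_bij_witness[of _ "\<lambda>(i, j). (j, i)" "\<lambda>(i, j). (j, i)"], auto simp: sym)
  ultimately show ?thesis by (simp add: sum.distrib)
qed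

lemma sum_trace_blocks:
  fixes C :: "'p::{finite,linorder} \<Rightarrow> 'p \<Rightarrow> real^'d^'d"
  shows "(\<Sum>i\<in>UNIV. \<Sum>j\<in>UNIV. trace (if i = j then S i else if i < j then C i j else transpose (C j i))) =
    (\<Sum>i\<in>UNIV. trace (S i)) + 2 * sdp_objective C"
  by (subst sum_square_upper_triangle)
     (auto simp: sdp_objective_def trace_def transpose_def intro!: sum.cong)

text \<open>In factored form the sum of the traces of all blocks is the squared norm of the sum of
  the block rows, and the diagonal blocks are prescribed. This is why the certificate comes from
  maximising that norm.\<close>

lemma sdp_objective_gram:
  assumes "cov_matrix S C = F ** transpose F"
  shows "2 * sdp_objective C =
    (\<Sum>i\<in>UNIV. block_row F i) \<bullet> (\<Sum>i\<in>UNIV. block_row F i) - (\<Sum>i\<in>UNIV. trace (S i))"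
proof -
  have "(\<Sum>i\<in>UNIV. block_row F i) \<bullet> (\<Sum>i\<in>UNIV. block_row F i) =
      (\<Sum>i\<in>UNIV. \<Sum>j\<in>UNIV. trace (block_row F i ** transpose (block_row F j)))"
    by (simp only: inner_sum_left inner_sum_right inner_eq_trace_transpose[of "block_row F _"])
       (rule sum.swap)
  then show ?thesis
    using sum_trace_blocks[of S C] assms unfolding cov_matrix_def block_matrix_eq_gram_iff by simp
qed

lemma block_row_stack_rows: "block_row (stack_rows A) i = A i"
  by (simp add: block_row_def stack_rows_def vec_eq_iff)

context barycentric_certificate
begin

text \<open>The duality gap of a family of factors. The number of columns is left free because a
  general feasible matrix is factored with dp columns, whereas \<open>A i\<close> has d.\<close>

definition defect :: "('p \<Rightarrow> real^'n^'d) \<Rightarrow> real" where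
  "defect G = (\<Sum>i\<in>UNIV. (G i - T i ** (\<Sum>j\<in>UNIV. G j)) \<bullet> (M i ** (G i - T i ** (\<Sum>j\<in>UNIV. G j))))"

lemma defect_nonneg: "0 \<le> defect G"
  unfolding defect_def
  by (intro sum_nonneg inner_matrix_mult_pos_semidef pos_def_imp_pos_semidef pos_def_M)

lemma defect_A: "defect A = 0"
  by (simp add: defect_def sum_A A_eq[symmetric])

text \<open>Weak duality: the part of the completed square that involves the \<open>M i\<close> sees
  \<open>G i\<close> only through its Gram matrix \<open>S i\<close>.\<close>

lemma sum_gram_defect:
  assumes "\<And>i. G i ** transpose (G i) = S i"
  shows "(\<Sum>i\<in>UNIV. G i) \<bullet> (\<Sum>i\<in>UNIV. G i) = (\<Sum>i\<in>UNIV. trace (M i ** S i)) - defect G"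
proof -
  have "G i \<bullet> (M i ** G i) = trace (M i ** S i)" for i
    unfolding assms[symmetric] inner_eq_trace by (metis matrix_mul_assoc trace_mul_sym)
  then show ?thesis using complete_square_matrix[of G] by (simp add: defect_def)
qed

text \<open>Factors are not unique, so only their products can be compared. Zero defect gives
  \<open>M i ** G i = Y\<close> for one common \<open>Y\<close>, hence
  \<open>Y ** transpose Y\<close> can be read off from \<open>S i\<close> alone, and it equals
  \<open>s ** transpose s\<close> by the same computation for \<open>A\<close>.\<close>

lemma defect_0_imp_gram:
  assumes G: "\<And>i. G i ** transpose (G i) = S i" and "defect G = 0"
  shows "G i ** transpose (G j) = A i ** transpose (A j)"
proof -
  define Y where "Y = (\<Sum>j\<in>UNIV. G j)"
  have "\<forall>i. (G i - T i ** Y) \<bullet> (M i ** (G i - T i ** Y)) = 0"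
    using assms(2) unfolding defect_def Y_def
    by (subst (asm) sum_nonneg_eq_0_iff)
       (auto intro!: inner_matrix_mult_pos_semidef pos_def_imp_pos_semidef pos_def_M)
  then have "M i ** (G i - T i ** Y) = 0" for i
    using inner_matrix_mult_pos_semidef(2) pos_def_imp_pos_semidef pos_def_M by blast
  then have MG: "M i ** G i = Y" for i
    by (simp add: matrix_diff_ldistrib matrix_mul_assoc MT)
  have GT: "G i = T i ** Y" for i by (metis MG TM matrix_mul_assoc matrix_mul_lid)
  have "Y ** transpose Y = M i ** S i ** transpose (M i)"
    by (simp add: MG[of i, symmetric] G[of i, symmetric] matrix_transpose_mul matrix_mul_assoc)
  also have "\<dots> = s ** transpose s"
    by (simp add: MA[of i, symmetric] gram[of i, symmetric] matrix_transpose_mul matrix_mul_assoc)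
  finally have YY: "Y ** transpose Y = s ** transpose s" .
  have "G i ** transpose (G j) = T i ** (Y ** transpose Y) ** transpose (T j)"
    by (simp add: GT matrix_transpose_mul matrix_mul_assoc)
  also have "\<dots> = A i ** transpose (A j)"
    by (simp add: YY A_eq matrix_transpose_mul matrix_mul_assoc)
  finally show ?thesis .
qed

end

lemma pos_semidef_cov_matrix_gram:
  fixes S :: "'p::{finite,linorder} \<Rightarrow> real^'d^'d"
  assumes "pos_semidef (cov_matrix S C)"
  obtains G :: "'p \<Rightarrow> real^('p \<times> 'd)^'d" where "cov_matrix S C = stack_rows G ** transpose (stack_rows G)"
    "\<And>i. G i ** transpose (G i) = S i"
proof -
  obtain F :: "real^('p \<times> 'd)^('p \<times> 'd)" where F: "cov_matrix S C = F ** transpose F"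
    using pos_semidef_factor[OF assms] by metis
  have "stack_rows (block_row F) = F"
    by (simp add: vec_eq_iff stack_rows_def block_row_def)
  moreover have "block_row F i ** transpose (block_row F i) = S i" for i
    using F unfolding cov_matrix_def block_matrix_eq_gram_iff by metis
  ultimately show ?thesis using that[of "block_row F"] F by simp
qed

lemma
  fixes S :: "'p::{finite,linorder} \<Rightarrow> real^'d^'d"
  assumes "barycentric_certificate S A M T s"
  shows sdp_solution_certificate: "sdp_solution S (\<lambda>i j. A i ** transpose (A j))"
    and sdp_solution_imp_cov_matrix:
      "\<And>C. sdp_solution S C \<Longrightarrow> cov_matrix S C = stack_rows A ** transpose (stack_rows A)"
proof -
  interpret barycentric_certificate S A M T s by (fact assms)
  let ?C = "\<lambda>i j. A i ** transpose (A j)"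
  let ?const = "(\<Sum>i\<in>UNIV. trace (M i ** S i)) - (\<Sum>i\<in>UNIV. trace (S i))"
  \<comment> \<open>On the feasible set the objective is a constant minus half the defect. Since
    \<open>A\<close> has defect 0, being optimal means having defect 0.\<close>
  have obj: "2 * sdp_objective C = ?const - defect G"
    if "cov_matrix S C = stack_rows G ** transpose (stack_rows G)" "\<And>i. G i ** transpose (G i) = S i"
    for C G
    using sdp_objective_gram[OF that(1)] sum_gram_defect[OF that(2)] by (simp add: block_row_stack_rows)
  have C: "cov_matrix S ?C = stack_rows A ** transpose (stack_rows A)"
    unfolding cov_matrix_def block_matrix_eq_gram_iff block_row_stack_rows
    by (simp add: gram matrix_transpose_mul)
  have objC: "2 * sdp_objective ?C = ?const"
    using obj[OF C gram] by (simp add: defect_A)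
  show sol: "sdp_solution S ?C"
    unfolding sdp_solution_def
  proof (intro conjI allI impI)
    show "pos_semidef (cov_matrix S ?C)" unfolding C by (rule pos_semidef_gram)
    fix C' assume "pos_semidef (cov_matrix S C')"
    then obtain G :: "'p \<Rightarrow> real^('p \<times> 'd)^'d" where "cov_matrix S C' = stack_rows G ** transpose (stack_rows G)"
      "\<And>i. G i ** transpose (G i) = S i" using pos_semidef_cov_matrix_gram by metis
    from obj[OF this] show "sdp_objective C' \<le> sdp_objective ?C"
      using objC defect_nonneg[of G] by linarith
  qed
  fix C' assume C': "sdp_solution S C'"
  then have "pos_semidef (cov_matrix S C')" by (simp add: sdp_solution_def)
  then obtain G :: "'p \<Rightarrow> real^('p \<times> 'd)^'d" where G: "cov_matrix S C' = stack_rows G ** transpose (stack_rows G)"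
      "\<And>i. G i ** transpose (G i) = S i" using pos_semidef_cov_matrix_gram by metis
  have "sdp_objective ?C \<le> sdp_objective C'" using C' sol by (simp add: sdp_solution_def)
  then have "defect G = 0" using obj[OF G] objC defect_nonneg[of G] by linarith
  from defect_0_imp_gram[OF G(2) this]
  have "block_row (stack_rows G) i ** transpose (block_row (stack_rows G) j) =
      block_row (stack_rows A) i ** transpose (block_row (stack_rows A) j)" for i j
    by (simp add: block_row_stack_rows)
  then show "cov_matrix S C' = stack_rows A ** transpose (stack_rows A)"
    using G(1) by (simp add: cov_matrix_def block_matrix_eq_gram_iff)
qed

lemma cov_matrix_inj:
  assumes "cov_matrix S C = cov_matrix S C'" "i < j"
  shows "C i j = C' i j"
proof -
  have "cov_matrix S C $ (i, k) $ (j, l) = C i j $ k $ l" for C k l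
    using assms(2) by (auto simp: cov_matrix_def block_matrix_def)
  then show ?thesis using assms(1) unfolding vec_eq_iff by metis
qed

section \<open>Gaussian measures\<close>

lemma nn_integral_lborel_translate:
  fixes f :: "'a::euclidean_space \<Rightarrow> ennreal"
  assumes [measurable]: "f \<in> borel_measurable borel"
  shows "(\<integral>\<^sup>+x. f (a + x) \<partial>lborel) = (\<integral>\<^sup>+x. f x \<partial>lborel)"
  by (subst (2) lborel_distr_plus[of a, symmetric]) (simp add: nn_integral_distr)

lemma nn_integral_lborel_reflect:
  fixes f :: "'a::euclidean_space \<Rightarrow> ennreal"
  assumes [measurable]: "f \<in> borel_measurable borel"
  shows "(\<integral>\<^sup>+x. f (a - x) \<partial>lborel) = (\<integral>\<^sup>+x. f x \<partial>lborel)"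
  by (subst (2) lborel_affine[of "-1" a]) (simp_all add: nn_integral_density nn_integral_distr)

lemma emeasure_distr_indicator:
  assumes [measurable]: "f \<in> M \<rightarrow>\<^sub>M N" "X \<in> sets N"
  shows "emeasure (distr M N f) X = (\<integral>\<^sup>+x. indicator X (f x) \<partial>M)"
proof -
  have "emeasure (distr M N f) X = (\<integral>\<^sup>+x. indicator X x \<partial>distr M N f)"
    by (rule nn_integral_indicator[symmetric]) simp
  also have "\<dots> = (\<integral>\<^sup>+x. indicator X (f x) \<partial>M)" by (rule nn_integral_distr) simp_all
  finally show ?thesis .
qed

text \<open>Uniqueness of translation-invariant measures: with \<open>g\<close> the indicator function of the unit
  ball, Tonelli's theorem and translations turn \<open>\<integral> h (f x) dx * \<integral> g (y) dy\<close> into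
  \<open>\<integral> g (f x) dx * \<integral> h (y) dy\<close>, and \<open>g \<circ> f = g\<close>.\<close>

lemma lborel_distr_orthogonal:
  fixes f :: "'a::euclidean_space \<Rightarrow> 'a"
  assumes f: "orthogonal_transformation f"
  shows "distr lborel borel f = lborel"
proof (rule measure_eqI)
  have lin: "linear f" using f by (rule orthogonal_transformation_linear)
  have [measurable]: "f \<in> borel \<rightarrow>\<^sub>M borel"
    by (intro borel_measurable_continuous_onI linear_continuous_on linear_conv_bounded_linear[THEN iffD1] lin)
  obtain f' where f': "\<And>y. f (f' y) = y"
    using orthogonal_transformation_surj[OF f] by (metis surjD)
  fix X assume "X \<in> sets (distr lborel borel f)"
  then have [measurable]: "X \<in> sets borel" by simp
  define h where "h = (indicator X :: 'a \<Rightarrow> ennreal)"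
  define g where "g = (indicator (ball 0 1) :: 'a \<Rightarrow> ennreal)"
  have [measurable]: "h \<in> borel_measurable borel" "g \<in> borel_measurable borel"
    unfolding h_def g_def by (intro borel_measurable_indicator; simp)+
  have gf: "g (f x) = g x" for x
    using f by (simp add: g_def indicator_def orthogonal_transformation_norm)
  let ?B = "\<integral>\<^sup>+y. g y \<partial>lborel"
  have "(\<integral>\<^sup>+x. h (f x) \<partial>lborel) * ?B = (\<integral>\<^sup>+x. \<integral>\<^sup>+y. h (f x) * g (f x + y) \<partial>lborel \<partial>lborel)"
    by (simp add: nn_integral_cmult nn_integral_multc nn_integral_lborel_translate)
  also have "\<dots> = (\<integral>\<^sup>+y. \<integral>\<^sup>+x. h (f x) * g (f x + y) \<partial>lborel \<partial>lborel)"
    by (rule lborel_pair.Fubini') simp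
  also have "\<dots> = (\<integral>\<^sup>+y. \<integral>\<^sup>+x. h (f x - y) * g (f x) \<partial>lborel \<partial>lborel)"
  proof (rule nn_integral_cong)
    fix y
    have "(\<integral>\<^sup>+x. h (f x) * g (f x + y) \<partial>lborel) = (\<integral>\<^sup>+x. h (f (- f' y + x)) * g (f (- f' y + x) + y) \<partial>lborel)"
      by (rule nn_integral_lborel_translate[symmetric]) simp
    then show "(\<integral>\<^sup>+x. h (f x) * g (f x + y) \<partial>lborel) = (\<integral>\<^sup>+x. h (f x - y) * g (f x) \<partial>lborel)"
      by (simp add: linear_diff[OF lin] f')
  qed
  also have "\<dots> = (\<integral>\<^sup>+x. \<integral>\<^sup>+y. h (f x - y) * g (f x) \<partial>lborel \<partial>lborel)"
    by (rule lborel_pair.Fubini'[symmetric]) simp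
  also have "\<dots> = (\<integral>\<^sup>+x. h x \<partial>lborel) * ?B"
    by (simp add: nn_integral_cmult nn_integral_multc nn_integral_lborel_reflect gf)
  finally have "(\<integral>\<^sup>+x. h (f x) \<partial>lborel) * ?B = (\<integral>\<^sup>+x. h x \<partial>lborel) * ?B" .
  moreover have "?B = emeasure lborel (ball (0::'a) 1)" by (simp add: g_def)
  moreover have "emeasure lborel (ball (0::'a) 1) \<noteq> \<infinity>" 
    using emeasure_lborel_ball_finite[of "0::'a" 1] by (simp add: less_top)
  moreover have "emeasure lborel (ball (0::'a) 1) \<noteq> 0"
    using content_ball_pos[of 1 "0::'a"] by (auto simp: measure_def)
  ultimately have "(\<integral>\<^sup>+x. h (f x) \<partial>lborel) = (\<integral>\<^sup>+x. h x \<partial>lborel)"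
    by (metis ennreal_mult_cancel_left infinity_ennreal_def mult.commute)
  moreover have "emeasure (distr lborel borel f) X = (\<integral>\<^sup>+x. h (f x) \<partial>lborel)"
    by (simp add: emeasure_distr_indicator h_def)
  ultimately show "emeasure (distr lborel borel f) X = emeasure lborel X" by (simp add: h_def)
qed simp

lemma borel_measurable_matrix_vector [measurable]: "(\<lambda>x. A *v x) \<in> borel \<rightarrow>\<^sub>M borel"
  for A :: "real^'n^'m"
  by (intro borel_measurable_continuous_onI matrix_vector_mult_linear_continuous_on)

lemma borel_measurable_vec_nth [measurable]: "(\<lambda>x :: 'a::euclidean_space^'n. x $ i) \<in> borel \<rightarrow>\<^sub>M borel"
  by (intro borel_measurable_continuous_onI continuous_intros)

lemma sets_std_gaussian [simp, measurable_cong]: "sets std_gaussian = sets borel"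
  by (simp add: std_gaussian_def)

lemma space_std_gaussian [simp]: "space std_gaussian = UNIV"
  by (simp add: std_gaussian_def)

text \<open>The product density is a function of the norm alone, so it is unchanged by
  \<open>Q\<close>, as is Lebesgue measure.\<close>

lemma std_gaussian_orthogonal:
  fixes Q :: "real^'n^'n"
  assumes Q: "orthogonal_matrix Q"
  shows "distr std_gaussian borel (\<lambda>z. Q *v z) = std_gaussian"
proof (rule measure_eqI)
  define \<rho> where "\<rho> x = ennreal (\<Prod>k\<in>UNIV. std_normal_density (x $ k))" for x :: "real^'n"
  have [measurable]: "\<rho> \<in> borel_measurable borel" unfolding \<rho>_def by measurable
  have orth: "orthogonal_transformation ((*v) Q)"
    using Q by (simp add: orthogonal_transformation_matrix)
  have "(\<Prod>k\<in>UNIV. std_normal_density (x $ k)) = (1 / sqrt (2 * pi)) ^ CARD('n) * exp (- (norm x)\<^sup>2 / 2)"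
    for x :: "real^'n"
  proof -
    have "(norm x)\<^sup>2 = (\<Sum>k\<in>UNIV. (x $ k)\<^sup>2)"
      unfolding power2_norm_eq_inner inner_vec_def by (simp add: power2_eq_square)
    then show ?thesis
      by (simp add: std_normal_density_def prod.distrib exp_sum[symmetric] sum_negf sum_divide_distrib
          power_divide prod_dividef)
  qed
  then have \<rho>Q: "\<rho> (Q *v x) = \<rho> x" for x
    using orthogonal_transformation_norm[OF orth] by (simp add: \<rho>_def)
  fix X assume "X \<in> sets (distr std_gaussian borel ((*v) Q))"
  then have [measurable]: "X \<in> sets borel" by simp
  have "emeasure std_gaussian X = (\<integral>\<^sup>+x. \<rho> x * indicator X x \<partial>lborel)"
    by (simp add: std_gaussian_def \<rho>_def emeasure_density)
  also have "\<dots> = (\<integral>\<^sup>+x. \<rho> x * indicator X x \<partial>distr lborel borel ((*v) Q))"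
    by (simp add: lborel_distr_orthogonal[OF orth])
  also have "\<dots> = (\<integral>\<^sup>+x. \<rho> x * indicator X (Q *v x) \<partial>lborel)"
    by (simp add: nn_integral_distr \<rho>Q)
  also have "\<dots> = (\<integral>\<^sup>+x. indicator X (Q *v x) \<partial>std_gaussian)"
    by (simp add: std_gaussian_def \<rho>_def[symmetric] nn_integral_density)
  also have "\<dots> = emeasure (distr std_gaussian borel ((*v) Q)) X"
    by (simp add: emeasure_distr_indicator)
  finally show "emeasure (distr std_gaussian borel ((*v) Q)) X = emeasure std_gaussian X" by simp
qed simp

section \<open>Product structure, second moments and coordinate marginals of the standard
  Gaussian\<close>

lemma Basis_real_vec: "(Basis :: (real^'n) set) = range (\<lambda>k. axis k 1)"
  by (auto simp: Basis_vec_def)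

lemma nn_integral_std_gaussian_prod:
  fixes f :: "'n::finite \<Rightarrow> real \<Rightarrow> ennreal"
  assumes [measurable]: "\<And>k. f k \<in> borel_measurable borel"
  shows "(\<integral>\<^sup>+x. (\<Prod>k\<in>UNIV. f k (x $ k)) \<partial>std_gaussian) =
    (\<Prod>k\<in>UNIV. \<integral>\<^sup>+x. f k x * ennreal (std_normal_density x) \<partial>lborel)"
proof -
  have inj: "inj (\<lambda>k. axis k (1::real) :: real^'n)" by (auto simp: inj_def axis_eq_axis)
  \<comment> \<open>The product formula for \<open>lborel\<close> is indexed by basis vectors;
    \<open>inv\<close> recovers the coordinate from its basis vector.\<close>
  define F where "F b x = f (inv (\<lambda>k. axis k (1::real) :: real^'n) b) x * ennreal (std_normal_density x)" for b x
  have F: "F (axis k 1) = (\<lambda>x. f k x * ennreal (std_normal_density x))" for k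
    using inv_f_f[OF inj, of k] by (simp add: F_def fun_eq_iff)
  have [measurable]: "F b \<in> borel_measurable borel" for b by (simp add: F_def[abs_def])
  have "(\<integral>\<^sup>+x. (\<Prod>k\<in>UNIV. f k (x $ k)) \<partial>std_gaussian) =
      (\<integral>\<^sup>+x. (\<Prod>k\<in>UNIV. f k (x $ k) * ennreal (std_normal_density (x $ k))) \<partial>lborel)"
    by (simp add: std_gaussian_def nn_integral_density prod_ennreal[symmetric] prod.distrib mult.commute)
  also have "\<dots> = (\<integral>\<^sup>+x. (\<Prod>b\<in>Basis. F b (x \<bullet> b)) \<partial>lborel)"
    by (simp add: Basis_real_vec prod.reindex[OF inj] F inner_axis)
  also have "\<dots> = (\<Prod>b\<in>Basis. \<integral>\<^sup>+x. F b x \<partial>lborel)"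
    by (rule nn_integral_lborel_prod) simp_all
  also have "\<dots> = (\<Prod>k\<in>UNIV. \<integral>\<^sup>+x. f k x * ennreal (std_normal_density x) \<partial>lborel)"
    by (simp add: Basis_real_vec prod.reindex[OF inj] F)
  finally show ?thesis .
qed

lemma nn_integral_std_normal_density: "(\<integral>\<^sup>+x. ennreal (std_normal_density x) \<partial>lborel) = 1"
  by (subst nn_integral_eq_integral) (auto intro: integrable_normal_density)

lemma prob_space_std_gaussian: "prob_space (std_gaussian :: (real^'n) measure)"
  using nn_integral_std_gaussian_prod[of "\<lambda>_::'n. \<lambda>_. 1"]
  by (intro prob_spaceI) (simp add: nn_integral_std_normal_density)

lemma integrable_std_gaussian_norm_square:
  "integrable std_gaussian (\<lambda>z :: real^'n. (norm z)\<^sup>2)"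
proof (rule integrableI_bounded)
  have fin: "(\<integral>\<^sup>+x. ennreal (x\<^sup>2) * ennreal (std_normal_density x) \<partial>lborel) < \<infinity>"
    using integrable_std_normal_moment[of 2] unfolding integrable_iff_bounded
    by (simp add: ennreal_mult'[symmetric] mult.commute abs_mult)
  have "(\<integral>\<^sup>+z. ennreal ((z $ k)\<^sup>2) \<partial>std_gaussian) < \<infinity>" for k :: 'n
  proof -
    let ?f = "\<lambda>c x. if c = k then ennreal (x\<^sup>2) else 1"
    have "(\<integral>\<^sup>+z. ennreal ((z $ k)\<^sup>2) \<partial>std_gaussian) = (\<integral>\<^sup>+z. (\<Prod>c\<in>UNIV. ?f c (z $ c)) \<partial>std_gaussian)"
      by simp
    also have "\<dots> = (\<Prod>c\<in>UNIV. \<integral>\<^sup>+x. ?f c x * ennreal (std_normal_density x) \<partial>lborel)"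
      by (rule nn_integral_std_gaussian_prod) simp
    also have "\<dots> < \<infinity>"
    proof -
      have "(\<integral>\<^sup>+x. ?f c x * ennreal (std_normal_density x) \<partial>lborel) < \<infinity>" for c
        using fin by (cases "c = k") (simp_all add: nn_integral_std_normal_density)
      then show ?thesis by (simp add: less_top[symmetric] ennreal_prod_eq_top)
    qed
    finally show ?thesis .
  qed
  moreover have "norm ((norm z)\<^sup>2) = (\<Sum>k\<in>UNIV. (z $ k)\<^sup>2)" for z :: "real^'n"
    unfolding power2_norm_eq_inner inner_vec_def
    by (simp add: power2_eq_square[symmetric] sum_nonneg)
  then have "ennreal (norm ((norm z)\<^sup>2)) = (\<Sum>k\<in>UNIV. ennreal ((z $ k)\<^sup>2))" for z :: "real^'n"
    by (simp only: sum_ennreal zero_le_power2)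
  then have "(\<integral>\<^sup>+z. ennreal (norm ((norm (z :: real^'n))\<^sup>2)) \<partial>std_gaussian) =
      (\<Sum>k\<in>(UNIV :: 'n set). \<integral>\<^sup>+z. ennreal ((z $ k)\<^sup>2) \<partial>std_gaussian)"
    by (subst nn_integral_sum[symmetric]) simp_all
  ultimately show "(\<integral>\<^sup>+z. ennreal (norm ((norm (z :: real^'n))\<^sup>2)) \<partial>std_gaussian) < \<infinity>"
    by (simp add: less_top[symmetric])
qed simp

text \<open>Boxes form an intersection-stable generator on which both measures factor over
  coordinates; each coordinate outside the range of \<open>\<iota>\<close> contributes total mass
  1.\<close>

lemma std_gaussian_projection:
  fixes \<iota> :: "'d::finite \<Rightarrow> 'n::finite"
  assumes \<iota>: "inj \<iota>"
  shows "distr std_gaussian borel (\<lambda>z :: real^'n. \<chi> k. z $ \<iota> k) = std_gaussian" (is "?D = _")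
proof (rule measure_eqI_generator_eq)
  let ?E = "range (\<lambda>(a, b). box a b :: (real^'d) set)"
  have [measurable]: "(\<lambda>z :: real^'n. \<chi> k. z $ \<iota> k) \<in> borel \<rightarrow>\<^sub>M borel"
    by (intro borel_measurable_continuous_onI continuous_intros)
  show "Int_stable ?E" by (auto simp: Int_stable_def box_Int_box)
  show "?E \<subseteq> Pow UNIV" "sets ?D = sigma_sets UNIV ?E" "sets std_gaussian = sigma_sets UNIV ?E"
    by (simp_all add: borel_eq_box)
  let ?A = "\<lambda>n::nat. box (- (real n *\<^sub>R One)) (real n *\<^sub>R One) :: (real^'d) set"
  show "range ?A \<subseteq> ?E" "(\<Union>i. ?A i) = UNIV"
    unfolding UN_box_eq_UNIV by auto
  interpret N: prob_space "std_gaussian :: (real^'n) measure" by (rule prob_space_std_gaussian)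
  show "emeasure ?D (?A i) \<noteq> \<infinity>" for i by (simp add: emeasure_distr)
  fix X assume "X \<in> ?E"
  then obtain a b :: "real^'d" where X: "X = box a b" by auto
  define I where "I k = (indicator {a $ k <..< b $ k} :: real \<Rightarrow> ennreal)" for k
  have [measurable]: "I k \<in> borel_measurable borel" for k by (simp add: I_def)
  have I: "indicator (box a b) x = (\<Prod>k\<in>UNIV. I k (x $ k))" for x
  proof (cases "x \<in> box a b")
    case False
    then obtain k where "\<not> (a $ k < x $ k \<and> x $ k < b $ k)" by (auto simp: mem_box_cart)
    then have "I k (x $ k) = 0" by (auto simp: I_def)
    then have "(\<Prod>k\<in>UNIV. I k (x $ k)) = 0" by (intro prod_zero) auto
    with False show ?thesis by simp
  qed (simp add: mem_box_cart I_def)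
  define f where "f c = (if c \<in> range \<iota> then I (inv \<iota> c) else (\<lambda>_. 1))" for c
  have [measurable]: "f c \<in> borel_measurable borel" for c by (simp add: f_def)
  have split: "(\<Prod>c\<in>UNIV. F c) = (\<Prod>k\<in>UNIV. F (\<iota> k))" if "\<And>c. c \<notin> range \<iota> \<Longrightarrow> F c = 1"
    for F :: "'n \<Rightarrow> ennreal"
    using prod.mono_neutral_right[of UNIV "range \<iota>" F] that prod.reindex[OF \<iota>, of F] by simp
  have f1: "f c = (\<lambda>_. 1)" if "c \<notin> range \<iota>" for c using that by (simp add: f_def)
  have f\<iota>: "f (\<iota> k) = I k" for k using \<iota> by (simp add: f_def)
  have "emeasure ?D X = (\<integral>\<^sup>+z. indicator (box a b) (\<chi> k. z $ \<iota> k) \<partial>std_gaussian)"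
    by (simp add: emeasure_distr_indicator X)
  also have "\<dots> = (\<integral>\<^sup>+z. (\<Prod>c\<in>UNIV. f c (z $ c)) \<partial>std_gaussian)"
    by (subst split) (simp_all add: f1 f\<iota> I)
  also have "\<dots> = (\<Prod>c\<in>UNIV. \<integral>\<^sup>+x. f c x * ennreal (std_normal_density x) \<partial>lborel)"
    by (rule nn_integral_std_gaussian_prod) simp
  also have "\<dots> = (\<Prod>k\<in>UNIV. \<integral>\<^sup>+x. I k x * ennreal (std_normal_density x) \<partial>lborel)"
    by (subst split) (simp_all add: f1 f\<iota> nn_integral_std_normal_density)
  also have "\<dots> = (\<integral>\<^sup>+x. (\<Prod>k\<in>UNIV. I k (x $ k)) \<partial>std_gaussian)"
    by (rule nn_integral_std_gaussian_prod[symmetric]) simp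
  also have "\<dots> = emeasure std_gaussian X"
    by (simp add: X flip: I)
  finally show "emeasure ?D X = emeasure std_gaussian X" .
qed

text \<open>The factor chosen by \<open>SOME\<close> is \<open>A ** Q\<close> for an orthogonal
  \<open>Q\<close>, and rotation invariance absorbs \<open>Q\<close>. Singular \<open>S\<close> is
  covered, as the optimal plan requires.\<close>

lemma gaussian_eq:
  fixes A S :: "real^'n^'n"
  assumes A: "A ** transpose A = S"
  shows "gaussian m S = distr std_gaussian borel (\<lambda>z. m + A *v z)"
proof -
  define B where "B = (SOME A :: real^'n^'n. A ** transpose A = S)"
  have "B ** transpose B = S" unfolding B_def by (rule someI[of "\<lambda>A. A ** transpose A = S", OF A])
  then obtain Q where Q: "orthogonal_matrix Q" "B = A ** Q"
    using same_gram_imp_orthogonal[of A B] A by metis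
  have "gaussian m S = distr std_gaussian borel ((\<lambda>z. m + A *v z) \<circ> (\<lambda>z. Q *v z))"
    by (simp add: gaussian_def B_def[symmetric] Q(2) matrix_vector_mul_assoc[symmetric] o_def)
  also have "\<dots> = distr (distr std_gaussian borel (\<lambda>z. Q *v z)) borel (\<lambda>z. m + A *v z)"
    by (rule distr_distr[symmetric]) simp_all
  finally show ?thesis by (simp add: std_gaussian_orthogonal[OF Q(1)])
qed

text \<open>\<open>P\<close> selects the coordinates in the range of \<open>\<iota>\<close>, so
  \<open>F ** P\<close> is \<open>F\<close> padded with zero columns to a square factor of the same
  matrix, and \<open>P\<close> maps standard Gaussian noise to standard Gaussian noise.\<close>

lemma gaussian_eq_low_rank:
  fixes F :: "real^'d^'n" and \<iota> :: "'d \<Rightarrow> 'n"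
  assumes \<iota>: "inj \<iota>"
  shows "gaussian m (F ** transpose F) = distr std_gaussian borel (\<lambda>z. m + F *v z)"
proof -
  define P :: "real^'n^'d" where "P = (\<chi> k c. if c = \<iota> k then 1 else 0)"
  have "(\<Sum>c\<in>UNIV. P $ i $ c * P $ j $ c) = (\<Sum>c\<in>{\<iota> i}. P $ i $ c * P $ j $ c)" for i j
    by (rule sum.mono_neutral_right) (auto simp: P_def)
  then have PP: "P ** transpose P = mat 1"
    using \<iota> by (simp add: vec_eq_iff matrix_matrix_mult_def transpose_def mat_def) (simp add: P_def inj_eq)
  have "(\<Sum>c\<in>UNIV. P $ i $ c * z $ c) = (\<Sum>c\<in>{\<iota> i}. P $ i $ c * z $ c)" for i z
    by (rule sum.mono_neutral_right) (auto simp: P_def)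
  then have Pz: "P *v z = (\<chi> k. z $ \<iota> k)" for z
    by (simp add: vec_eq_iff matrix_vector_mult_def) (simp add: P_def)
  have "(F ** P) ** transpose (F ** P) = F ** transpose F"
    by (simp add: matrix_transpose_mul) (metis PP matrix_mul_assoc matrix_mul_rid)
  then have "gaussian m (F ** transpose F) = distr std_gaussian borel (\<lambda>z. m + (F ** P) *v z)"
    by (rule gaussian_eq)
  also have "\<dots> = distr std_gaussian borel ((\<lambda>z. m + F *v z) \<circ> (\<lambda>z. P *v z))"
    by (simp add: matrix_vector_mul_assoc[symmetric] o_def)
  also have "\<dots> = distr (distr std_gaussian borel (\<lambda>z. P *v z)) borel (\<lambda>z. m + F *v z)"
    by (rule distr_distr[symmetric]) simp_all
  also have "distr std_gaussian borel (\<lambda>z. P *v z) = std_gaussian"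
    by (simp add: Pz std_gaussian_projection[OF \<iota>])
  finally show ?thesis .
qed

section \<open>The transport problem\<close>

text \<open>The marginals have finite second moments, so under any coupling every quadratic
  expression in the coordinates is integrable. This is what permits splitting the integral of the
  cost into terms of either sign.\<close>

definition square_integrable :: "'a measure \<Rightarrow> ('a \<Rightarrow> 'b::euclidean_space) \<Rightarrow> bool" where
  "square_integrable M f \<longleftrightarrow> f \<in> borel_measurable M \<and> integrable M (\<lambda>x. (norm (f x))\<^sup>2)"

lemma square_integrable_inner:
  assumes "square_integrable M f" "square_integrable M g"
  shows "integrable M (\<lambda>x. f x \<bullet> g x)"
proof (rule Bochner_Integration.integrable_bound)
  show "integrable M (\<lambda>x. (norm (f x))\<^sup>2 + (norm (g x))\<^sup>2)"
    using assms by (simp add: square_integrable_def)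
  show "(\<lambda>x. f x \<bullet> g x) \<in> borel_measurable M"
    using assms by (auto simp: square_integrable_def)
  have "\<bar>u \<bullet> v\<bar> \<le> (norm u)\<^sup>2 + (norm v)\<^sup>2" for u v :: 'b
    using Cauchy_Schwarz_ineq2[of u v] sum_squares_bound[of "norm u" "norm v"]
      mult_nonneg_nonneg[OF norm_ge_zero norm_ge_zero, of u v] by linarith
  then show "AE x in M. norm (f x \<bullet> g x) \<le> norm ((norm (f x))\<^sup>2 + (norm (g x))\<^sup>2)" by simp
qed

lemma square_integrable_add:
  assumes "square_integrable M f" "square_integrable M g"
  shows "square_integrable M (\<lambda>x. f x + g x)"
  using assms square_integrable_inner[OF assms] unfolding square_integrable_def
  by (auto simp: power2_norm_eq_inner inner_add_left inner_add_right inner_commute)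

lemma square_integrable_bounded_linear:
  assumes L: "bounded_linear L" and f: "square_integrable M f"
  shows "square_integrable M (\<lambda>x. L (f x))"
  unfolding square_integrable_def
proof
  have [measurable]: "f \<in> borel_measurable M" using f by (simp add: square_integrable_def)
  have [measurable]: "L \<in> borel_measurable borel"
    using L by (intro borel_measurable_continuous_onI linear_continuous_on)
  show meas: "(\<lambda>x. L (f x)) \<in> borel_measurable M" by measurable
  obtain K where K: "\<And>x. norm (L x) \<le> norm x * K" using bounded_linear.bounded[OF L] by blast
  show "integrable M (\<lambda>x. (norm (L (f x)))\<^sup>2)"
  proof (rule Bochner_Integration.integrable_bound)
    show "integrable M (\<lambda>x. (norm (f x))\<^sup>2 * K\<^sup>2)" using f by (simp add: square_integrable_def)
    have "(norm (L u))\<^sup>2 \<le> (norm u)\<^sup>2 * K\<^sup>2" for u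
      using power_mono[OF K norm_ge_zero, of u 2] by (simp only: power_mult_distrib)
    then show "AE x in M. norm ((norm (L (f x)))\<^sup>2) \<le> norm ((norm (f x))\<^sup>2 * K\<^sup>2)"
      by simp
  qed (use meas in measurable)
qed

lemma square_integrable_matrix:
  fixes f :: "'a \<Rightarrow> real^'n" and B :: "real^'n^'m"
  shows "square_integrable M f \<Longrightarrow> square_integrable M (\<lambda>x. B *v f x)"
  by (rule square_integrable_bounded_linear[OF matrix_vector_mul_bounded_linear])

lemma square_integrable_diff:
  assumes "square_integrable M f" "square_integrable M g"
  shows "square_integrable M (\<lambda>x. f x - g x)"
  using square_integrable_add[OF assms(1), of "\<lambda>x. - g x"]
    square_integrable_bounded_linear[OF bounded_linear_minus[OF bounded_linear_ident] assms(2)] by simp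

lemma square_integrable_sum:
  assumes "finite I" "\<And>i. i \<in> I \<Longrightarrow> square_integrable M (f i)"
  shows "square_integrable M (\<lambda>x. \<Sum>i\<in>I. f i x)"
  using assms
  by (induction I rule: finite_induct) (simp_all add: square_integrable_add, simp add: square_integrable_def)

lemma square_integrable_const: "finite_measure M \<Longrightarrow> square_integrable M (\<lambda>_. c)"
  by (simp add: square_integrable_def finite_measure.integrable_const)

section \<open>Splitting the cost into single-coordinate functions and a nonnegative gap\<close>

lemma cost_eq:
  fixes x :: "'p::{finite,linorder} \<Rightarrow> 'a::real_inner"
  shows "(\<Sum>i\<in>UNIV. \<Sum>j\<in>{i<..}. (norm (x i - x j))\<^sup>2) =
    real CARD('p) * (\<Sum>i\<in>UNIV. x i \<bullet> x i) - (\<Sum>i\<in>UNIV. x i) \<bullet> (\<Sum>i\<in>UNIV. x i)"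
proof -
  have "2 * (\<Sum>i\<in>UNIV. \<Sum>j\<in>{i<..}. (norm (x i - x j))\<^sup>2) = (\<Sum>i\<in>UNIV. \<Sum>j\<in>UNIV. (norm (x i - x j))\<^sup>2)"
    by (subst sum_square_upper_triangle) (simp_all add: norm_minus_commute)
  also have "\<dots> = (\<Sum>i\<in>UNIV. \<Sum>j\<in>UNIV. x i \<bullet> x i + x j \<bullet> x j - 2 * (x i \<bullet> x j))"
    by (intro sum.cong refl) (simp add: power2_norm_eq_inner inner_diff_left inner_diff_right inner_commute)
  also have "\<dots> = 2 * real CARD('p) * (\<Sum>i\<in>UNIV. x i \<bullet> x i) - 2 * (\<Sum>i\<in>UNIV. \<Sum>j\<in>UNIV. x i \<bullet> x j)"
    by (simp add: sum.distrib sum_subtractf sum_distrib_left mult.assoc)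
  also have "(\<Sum>i\<in>UNIV. \<Sum>j\<in>UNIV. x i \<bullet> x j) = (\<Sum>i\<in>UNIV. x i) \<bullet> (\<Sum>i\<in>UNIV. x i)"
    by (simp add: inner_sum_left inner_sum_right) (rule sum.swap)
  finally show ?thesis by simp
qed

context barycentric_certificate
begin

definition gap :: "('p \<Rightarrow> real^'d) \<Rightarrow> (real^'d)^'p \<Rightarrow> real" where
  "gap m x = (\<Sum>i\<in>UNIV. (x $ i - m i - T i *v (\<Sum>j\<in>UNIV. x $ j - m j)) \<bullet>
     (M i *v (x $ i - m i - T i *v (\<Sum>j\<in>UNIV. x $ j - m j))))"

lemma gap_nonneg: "0 \<le> gap m x"
  unfolding gap_def by (intro sum_nonneg pos_semidefD pos_def_imp_pos_semidef pos_def_M)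

text \<open>The points of zero gap form a graph over any single coordinate \<open>k\<close>: that
  coordinate gives back the common vector \<open>y\<close>, and \<open>y\<close> gives all the
  others.\<close>

lemma gap_eq_0:
  assumes "gap m x = 0"
  shows "x $ i = m i + T i *v (M k *v (x $ k - m k))"
proof -
  define y where "y = (\<Sum>j\<in>UNIV. x $ j - m j)"
  have "\<forall>i. (x $ i - m i - T i *v y) \<bullet> (M i *v (x $ i - m i - T i *v y)) = 0"
    using assms unfolding gap_def y_def
    by (subst (asm) sum_nonneg_eq_0_iff) (auto intro!: pos_semidefD pos_def_imp_pos_semidef pos_def_M)
  then have eq: "x $ i - m i = T i *v y" for i
    using pos_def_M unfolding pos_def_def by (metis less_irrefl right_minus_eq)
  then have "M k *v (x $ k - m k) = y"
    by (simp add: matrix_vector_mul_assoc MT)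
  then show ?thesis using eq[of i] by (simp add: algebra_simps)
qed

lemma gap_barycentric: "gap m (\<chi> i. m i + A i *v z) = 0"
proof -
  have "(\<Sum>j\<in>UNIV. A j *v z) = s *v z"
    by (simp add: sum_A flip: matrix_vector_mult_sum_left)
  then show ?thesis by (simp add: gap_def matrix_vector_mul_assoc A_eq[symmetric])
qed

text \<open>Kantorovich potentials, found by subtracting \<open>gap\<close> from the cost. The first
  term comes from \<open>cost_eq\<close>, the second from the \<open>M i\<close> part of the gap,
  and the linear one is what remains of the squared norms of the sum of the points, uncentred and
  centred.\<close>

definition potential :: "('p \<Rightarrow> real^'d) \<Rightarrow> 'p \<Rightarrow> real^'d \<Rightarrow> real" where
  "potential m i v = real CARD('p) * (v \<bullet> v) - (v - m i) \<bullet> (M i *v (v - m i)) - 2 * (v \<bullet> (\<Sum>j\<in>UNIV. m j))"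

lemma cost_decomposition:
  "real CARD('p) * (\<Sum>i\<in>UNIV. x $ i \<bullet> x $ i) - (\<Sum>i\<in>UNIV. x $ i) \<bullet> (\<Sum>i\<in>UNIV. x $ i) =
    gap m x + (\<Sum>i\<in>UNIV. potential m i (x $ i)) + (\<Sum>j\<in>UNIV. m j) \<bullet> (\<Sum>j\<in>UNIV. m j)"
proof -
  define X where "X = (\<Sum>i\<in>UNIV. x $ i)"
  define m' where "m' = (\<Sum>j\<in>UNIV. m j)"
  have "gap m x = (\<Sum>i\<in>UNIV. (x $ i - m i) \<bullet> (M i *v (x $ i - m i))) - (X - m') \<bullet> (X - m')"
    using complete_square[of "\<lambda>i. x $ i - m i"] by (simp add: gap_def X_def m'_def sum_subtractf)
  moreover have "(\<Sum>i\<in>UNIV. potential m i (x $ i)) = real CARD('p) * (\<Sum>i\<in>UNIV. x $ i \<bullet> x $ i)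
      - (\<Sum>i\<in>UNIV. (x $ i - m i) \<bullet> (M i *v (x $ i - m i))) - 2 * (X \<bullet> m')"
    by (simp add: potential_def sum_subtractf sum_distrib_left inner_sum_left X_def m'_def)
  ultimately show ?thesis
    by (simp add: X_def[symmetric] m'_def[symmetric] inner_diff_left inner_diff_right inner_commute)
qed

end

lemma unstack_stack_rows: "unstack (stack m + stack_rows A *v z) = (\<chi> i. m i + A i *v z)"
  by (simp add: vec_eq_iff unstack_def stack_def stack_rows_mult)

lemma borel_measurable_unstack [measurable]: "unstack \<in> borel \<rightarrow>\<^sub>M borel"
  unfolding unstack_def by (intro borel_measurable_continuous_onI continuous_intros)

lemma distr_gaussian_unstack:
  fixes A :: "'p::finite \<Rightarrow> real^'d^'d"
  shows "distr (gaussian (stack m) (stack_rows A ** transpose (stack_rows A))) borel unstack =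
    distr std_gaussian borel (\<lambda>z. \<chi> i. m i + A i *v z)"
proof -
  \<comment> \<open>The d noise coordinates are placed in an arbitrary fixed block.\<close>
  have "inj (\<lambda>k. (undefined :: 'p, k :: 'd))" by (simp add: inj_def)
  from gaussian_eq_low_rank[OF this]
  have "distr (gaussian (stack m) (stack_rows A ** transpose (stack_rows A))) borel unstack =
      distr (distr std_gaussian borel (\<lambda>z. stack m + stack_rows A *v z)) borel unstack" by simp
  also have "\<dots> = distr std_gaussian borel (unstack \<circ> (\<lambda>z. stack m + stack_rows A *v z))"
    by (rule distr_distr) simp_all
  finally show ?thesis by (simp add: o_def unstack_stack_rows)
qed

lemma square_integrable_gaussian:
  fixes A S :: "real^'n^'n"
  assumes "A ** transpose A = S"
  shows "square_integrable (gaussian m S) (\<lambda>x. x)"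
proof -
  have "square_integrable std_gaussian (\<lambda>z :: real^'n. z)"
    by (simp add: square_integrable_def integrable_std_gaussian_norm_square)
  then have "square_integrable std_gaussian (\<lambda>z. m + A *v z)"
    by (intro square_integrable_add square_integrable_matrix square_integrable_const
        prob_space.finite_measure prob_space_std_gaussian)
  then show ?thesis
    by (simp add: gaussian_eq[OF assms] square_integrable_def integrable_distr_eq)
qed

lemma optimal_plan_iff_barycentric:
  fixes m :: "'p::{finite,linorder} \<Rightarrow> real^'d"
  assumes "barycentric_certificate S A M T s" and \<mu>: "\<And>i. \<mu> i = gaussian (m i) (S i)"
  shows "optimal_plan \<mu> \<pi> \<longleftrightarrow> \<pi> = distr std_gaussian borel (\<lambda>z. \<chi> i. m i + A i *v z)"
proof -
  interpret barycentric_certificate S A M T s by (fact assms)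
  define \<pi>0 where "\<pi>0 = distr std_gaussian borel (\<lambda>z. \<chi> i. m i + A i *v z)"
  have meas [measurable]: "(\<lambda>z. \<chi> i. m i + A i *v z) \<in> borel \<rightarrow>\<^sub>M borel"
    by (intro borel_measurable_continuous_onI continuous_intros matrix_vector_mult_linear_continuous_on)
  have \<mu>_eq: "\<mu> i = distr std_gaussian borel (\<lambda>z. m i + A i *v z)" for i
    by (simp add: \<mu> gaussian_eq[OF gram])
  have sets_\<mu> [simp, measurable_cong]: "sets (\<mu> i) = sets borel" for i by (simp add: \<mu>_eq)
  have si_\<mu>: "square_integrable (\<mu> i) (\<lambda>x. x)" for i
    unfolding \<mu> by (rule square_integrable_gaussian[OF gram])
  have prob_\<mu>: "prob_space (\<mu> i)" for i
    unfolding \<mu>_eq by (intro prob_space.prob_space_distr prob_space_std_gaussian) simp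
  \<comment> \<open>The dual value: all of the cost except the gap, depending on a coupling only
    through its marginals.\<close>
  define K where "K = (\<Sum>i\<in>UNIV. \<integral>v. potential m i v \<partial>\<mu> i) + (\<Sum>j\<in>UNIV. m j) \<bullet> (\<Sum>j\<in>UNIV. m j)"

  \<comment> \<open>\<open>ennreal\<close> truncates negative reals, so nonnegativity is carried
    along to bring comparisons of costs back to the reals. Integrability of the gap is kept so that
    a zero integral forces a zero gap almost everywhere.\<close>
  have coupling: "transport_cost \<pi> = ennreal ((\<integral>x. gap m x \<partial>\<pi>) + K) \<and> 0 \<le> (\<integral>x. gap m x \<partial>\<pi>) + K
      \<and> integrable \<pi> (gap m)"
    if "\<pi> \<in> couplings \<mu>" for \<pi>
  proof -
    have [simp, measurable_cong]: "sets \<pi> = sets borel" and "prob_space \<pi>"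
      and marg: "\<And>i. distr \<pi> borel (\<lambda>x. x $ i) = \<mu> i"
      using that by (auto simp: couplings_def)
    interpret prob_space \<pi> by fact
    have si: "square_integrable \<pi> (\<lambda>x. x $ i)" for i
      using si_\<mu>[of i] unfolding square_integrable_def marg[of i, symmetric]
      by (simp add: integrable_distr_eq)
    have si_const: "square_integrable \<pi> (\<lambda>_. c)" for c :: "real^'d"
      by (intro square_integrable_const) unfold_locales
    have int_gap: "integrable \<pi> (gap m)"
      unfolding gap_def[abs_def]
      by (intro Bochner_Integration.integrable_sum square_integrable_inner square_integrable_diff
          square_integrable_matrix square_integrable_sum si si_const finite_class.finite_UNIV)
    have si_const\<mu>: "square_integrable (\<mu> i) (\<lambda>_. c)" for c :: "real^'d" and i
      using prob_\<mu> by (intro square_integrable_const prob_space.finite_measure)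
    have int_pot\<mu>: "integrable (\<mu> i) (potential m i)" for i
      unfolding potential_def[abs_def]
      by (intro Bochner_Integration.integrable_diff integrable_mult_right square_integrable_inner
          square_integrable_diff square_integrable_matrix si_\<mu> si_const\<mu>)
    have pot_meas: "potential m i \<in> borel_measurable borel" for i
      using borel_measurable_integrable[OF int_pot\<mu>] by simp
    have int_pot: "integrable \<pi> (\<lambda>x. potential m i (x $ i))"
      and pot_eq: "(\<integral>x. potential m i (x $ i) \<partial>\<pi>) = (\<integral>v. potential m i v \<partial>\<mu> i)" for i
      using int_pot\<mu>[of i] pot_meas unfolding marg[of i, symmetric]
      by (simp_all add: integrable_distr_eq integral_distr)
    define c where "c x = gap m x + (\<Sum>i\<in>UNIV. potential m i (x $ i)) + (\<Sum>j\<in>UNIV. m j) \<bullet> (\<Sum>j\<in>UNIV. m j)" for x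
    have c: "(\<Sum>i\<in>UNIV. \<Sum>j\<in>{i<..}. (norm (x $ i - x $ j))\<^sup>2) = c x" for x
      unfolding c_def by (simp only: cost_eq cost_decomposition)
    have c_nonneg: "0 \<le> c x" for x unfolding c[symmetric] by (intro sum_nonneg) auto
    have "integrable \<pi> c"
      unfolding c_def[abs_def]
      by (intro Bochner_Integration.integrable_add Bochner_Integration.integrable_sum int_gap int_pot integrable_const)
    moreover have "(\<integral>x. c x \<partial>\<pi>) = (\<integral>x. gap m x \<partial>\<pi>) + K"
      by (simp add: c_def K_def int_gap int_pot pot_eq prob_space)
    ultimately show ?thesis
      using int_gap c_nonneg by (simp add: transport_cost_def c nn_integral_eq_integral)
        (metis Bochner_Integration.integral_nonneg)
  qed

  have \<pi>0: "\<pi>0 \<in> couplings \<mu>"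
    unfolding couplings_def
  proof (intro CollectI conjI allI)
    show "sets \<pi>0 = sets borel" by (simp add: \<pi>0_def)
    show "prob_space \<pi>0"
      unfolding \<pi>0_def by (intro prob_space.prob_space_distr prob_space_std_gaussian) simp
    fix i
    have "distr \<pi>0 borel (\<lambda>x. x $ i) = distr std_gaussian borel ((\<lambda>x. x $ i) \<circ> (\<lambda>z. \<chi> i. m i + A i *v z))"
      unfolding \<pi>0_def by (rule distr_distr) simp_all
    then show "distr \<pi>0 borel (\<lambda>x. x $ i) = \<mu> i" by (simp add: \<mu>_eq o_def)
  qed
  have gap\<pi>0: "(\<integral>x. gap m x \<partial>\<pi>0) = 0"
    using coupling[OF \<pi>0] unfolding \<pi>0_def by (subst integral_distr) (auto simp: gap_barycentric)

  have optimal_iff: "optimal_plan \<mu> \<pi> \<longleftrightarrow> \<pi> \<in> couplings \<mu> \<and> (\<integral>x. gap m x \<partial>\<pi>) = 0" for \<pi>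
  proof
    assume opt: "optimal_plan \<mu> \<pi>"
    then have \<pi>: "\<pi> \<in> couplings \<mu>" "transport_cost \<pi> \<le> transport_cost \<pi>0"
      using \<pi>0 by (auto simp: optimal_plan_def)
    then have "(\<integral>x. gap m x \<partial>\<pi>) \<le> 0"
      using coupling[OF \<pi>(1)] coupling[OF \<pi>0] by (simp add: gap\<pi>0)
    moreover have "0 \<le> (\<integral>x. gap m x \<partial>\<pi>)" by (simp add: gap_nonneg)
    ultimately show "\<pi> \<in> couplings \<mu> \<and> (\<integral>x. gap m x \<partial>\<pi>) = 0" using \<pi>(1) by simp
  next
    assume \<pi>: "\<pi> \<in> couplings \<mu> \<and> (\<integral>x. gap m x \<partial>\<pi>) = 0"
    have "transport_cost \<pi> \<le> transport_cost \<pi>'" if "\<pi>' \<in> couplings \<mu>" for \<pi>'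
    proof -
      have "0 \<le> (\<integral>x. gap m x \<partial>\<pi>')" by (simp add: gap_nonneg)
      then show ?thesis using coupling[OF that] coupling[of \<pi>] \<pi> by (simp add: ennreal_leI)
    qed
    then show "optimal_plan \<mu> \<pi>" using \<pi> by (simp add: optimal_plan_def)
  qed

  define k :: 'p where "k = undefined"
  \<comment> \<open>\<open>G\<close> rebuilds a point of zero gap from its coordinate
    \<open>k\<close>. A coupling whose gap integrates to 0 is therefore the image of
    \<open>\<mu> k\<close> under \<open>G\<close>, and so is \<open>\<pi>0\<close>, which proves
    uniqueness.\<close>
  define G where "G v = (\<chi> i. m i + T i *v (M k *v (v - m k)))" for v
  have [measurable]: "G \<in> borel \<rightarrow>\<^sub>M borel"
    unfolding G_def
    by (intro borel_measurable_continuous_onI continuous_intros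
        continuous_on_compose2[OF matrix_vector_mult_linear_continuous_on]) auto
  have zero_gap: "\<pi> = distr (\<mu> k) borel G" if "\<pi> \<in> couplings \<mu>" "(\<integral>x. gap m x \<partial>\<pi>) = 0" for \<pi>
  proof -
    have sets [simp, measurable_cong]: "sets \<pi> = sets borel"
      and marg: "distr \<pi> borel (\<lambda>x. x $ k) = \<mu> k"
      using that by (auto simp: couplings_def)
    have "AE x in \<pi>. gap m x = 0"
      using that coupling by (subst integral_nonneg_eq_0_iff_AE[symmetric]) (auto simp: gap_nonneg)
    then have AE: "AE x in \<pi>. x = G (x $ k)"
    proof (rule AE_mp, intro AE_I2 impI)
      fix x assume "gap m x = 0"
      from gap_eq_0[OF this, of _ k] show "x = G (x $ k)" by (simp add: vec_eq_iff G_def)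
    qed
    have "\<pi> = distr \<pi> borel (\<lambda>x. x)" by (simp add: distr_id2)
    also have "\<dots> = distr \<pi> borel (G \<circ> (\<lambda>x. x $ k))"
      by (rule distr_cong_AE) (use AE in auto)
    also have "\<dots> = distr (distr \<pi> borel (\<lambda>x. x $ k)) borel G"
      by (rule distr_distr[symmetric]) simp_all
    finally show ?thesis by (simp add: marg)
  qed
  have "optimal_plan \<mu> \<pi> \<longleftrightarrow> \<pi> = \<pi>0"
    using optimal_iff zero_gap[of \<pi>] zero_gap[OF \<pi>0 gap\<pi>0] \<pi>0 gap\<pi>0 by auto
  then show ?thesis by (simp add: \<pi>0_def)
qed

theorem mainTheorem6:
  fixes m :: "'p::{finite,linorder} \<Rightarrow> real^'d"
    and S :: "'p \<Rightarrow> real^'d^'d"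
    and \<mu> :: "'p \<Rightarrow> (real^'d) measure"
  assumes "\<And>i. pos_def (S i)"
    and "\<And>i. \<mu> i = gaussian (m i) (S i)"
  shows "(\<exists>C. sdp_solution S C) \<and>
         (\<forall>C C'. sdp_solution S C \<and> sdp_solution S C' \<longrightarrow> (\<forall>i j. i < j \<longrightarrow> C i j = C' i j)) \<and>
         (\<forall>C. sdp_solution S C \<longrightarrow>
            rank (cov_matrix S C) = CARD('d) \<and>
            (\<forall>\<pi>. optimal_plan \<mu> \<pi> \<longleftrightarrow>
                 \<pi> = distr (gaussian (stack m) (cov_matrix S C)) borel unstack))"
proof -
  obtain A M T s where cert: "barycentric_certificate S A M T s"
    using barycentric_certificate_exists[of S] assms(1) by blast
  note cov = sdp_solution_imp_cov_matrix[OF cert]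
  have "\<exists>C. sdp_solution S C"
    using sdp_solution_certificate[OF cert] by blast
  moreover have "C i j = C' i j" if "sdp_solution S C" "sdp_solution S C'" "i < j" for C C' i j
    using cov_matrix_inj[of S C C' i j] cov[OF that(1)] cov[OF that(2)] that(3) by simp
  moreover have "rank (cov_matrix S C) = CARD('d)" if "sdp_solution S C" for C
    unfolding cov[OF that] by (rule barycentric_certificate.rank_stack_rows_gram[OF cert])
  moreover have "optimal_plan \<mu> \<pi> \<longleftrightarrow> \<pi> = distr (gaussian (stack m) (cov_matrix S C)) borel unstack"
    if "sdp_solution S C" for C \<pi>
    unfolding cov[OF that] distr_gaussian_unstack
    by (rule optimal_plan_iff_barycentric[OF cert assms(2)])
  ultimately show ?thesis by blast
qed

end
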